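(* Let $\lambda$ be a bi-partition of $r$ with conjugate $\lambda'$. Over any field $F$ of characteristic $p$, the dual Specht module $S'(\lambda')$ is isomorphic, as an $FW_r$-module, to $S(\lambda)\otimes_F S\big((1^r),(0)\big)$.
   Context: $r\ge1$ and modules are finite-dimensional right modules. $W_r$ is the hyperoctahedral group: permutations $\sigma$ of $\{\pm1,\dots,\pm r\}$ with $\sigma(-i)=-\sigma(i)$ (acting on the right on symbols); $FW_r$ is its group algebra over $F$, and tensor products carry the diagonal action. Each $\sigma\in W_r$ is uniquely a product of sign changes $\xi_i$ (swapping $i$ and $-i$, fixing the other symbols) times some $\pi\in\mathfrak S_r$; put $\mathrm{sgn}\,\sigma=(-1)^{x}\mathrm{sgn}\,\pi$ with $x$ the number of sign changes. A bi-partition $\lambda=(\lambda^1,\lambda^2)$ of $r$ is a pair of (possibly empty) partitions with $|\lambda^1|+|\lambda^2|=r$; $(0)$ denotes the empty partition. The conjugate of $\lambda$ is $\lambda'=((\lambda^2)',(\lambda^1)')$, where $'$ on a partition is the usual conjugate (transpose). A $\lambda$-bi-tableau $t=(t^1,t^2)$ is a filling of the boxes of the Young diagrams of $\lambda^1,\lambda^2$ by elements of $\{\pm1,\dots,\pm r\}$ in which every absolute value $1,\dots,r$ occurs exactly once; $W_r$ acts on bi-tableaux on the right through the entries. $R_t\le W_r$ is the group of elements permuting the entries within each row of $t$, possibly changing signs of entries of $t^2$ (but not of $t^1$); $C_t\le W_r$ is the group of elements permuting the entries within each column of $t$, possibly changing signs of entries of $t^1$ (but not of $t^2$). Put $t_1\sim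 t_2$ if $t_2=t_1\sigma$ for some $\sigma\in R_{t_1}$; the class of $t$ is the bi-tabloid $\{t\}$. The permutation module $M(\lambda)$ is the $F$-space with basis the $\lambda$-bi-tabloids, with action $\{t\}\sigma=\{t\sigma\}$. Put $k_t=\sum_{\sigma\in C_t}(\mathrm{sgn}\,\sigma)\sigma$ and $e_t=\{t\}k_t$. The Specht module $S(\lambda)\subseteq M(\lambda)$ is the span of all $e_t$; the dual Specht module is $S'(\lambda)=S(\lambda)^*$ (contragredient dual). The module $S((1^r),(0))$ is the one-dimensional sign module, on which $\sigma$ acts by $\mathrm{sgn}\,\sigma$. *)

theory Defs
  imports
    Complex_Main
    "HOL-Library.Function_Algebras"
    "HOL-Library.Set_Algebras"
    "HOL-Combinatorics.Permutations"
begin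

section \<open>The hyperoctahedral group\<close>

definition symbols :: "nat \<Rightarrow> int set" where
  "symbols r = {i. 1 \<le> \<bar>i\<bar> \<and> \<bar>i\<bar> \<le> int r}"

text \<open>
  Elements act on symbols from the right, i.e. the symbol \<open>i\<sigma>\<close> is \<open>\<sigma> i\<close> and the product
  \<open>\<sigma>\<tau>\<close> (first \<open>\<sigma>\<close>, then \<open>\<tau>\<close>) is the function \<open>\<tau> \<circ> \<sigma>\<close>.
\<close>

definition hyperoct :: "nat \<Rightarrow> (int \<Rightarrow> int) set" where
  "hyperoct r = {\<sigma>. \<sigma> permutes symbols r \<and> (\<forall>i. \<sigma> (- i) = - \<sigma> i)}"

text \<open>
  Writing \<open>\<sigma>\<close> as a product of sign changes \<open>\<xi>\<^sub>i\<close> followed by \<open>\<pi>\<close> in the symmetric group, \<open>\<pi>\<close>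
  sends \<open>i > 0\<close> to \<open>\<bar>i\<sigma>\<bar>\<close>, and \<open>\<xi>\<^sub>i\<close> occurs iff \<open>i\<sigma> < 0\<close>
  (see \<open>hyperoct_decompose\<close> and \<open>hyp_sgn_decompose\<close> below).
\<close>

definition hyp_sgn :: "nat \<Rightarrow> (int \<Rightarrow> int) \<Rightarrow> int" where
  "hyp_sgn r \<sigma> = (- 1) ^ card {i \<in> {1..int r}. \<sigma> i < 0} * sign_on {1..int r} (\<lambda>i. \<bar>\<sigma> i\<bar>)"

definition sign_changes :: "int set \<Rightarrow> int \<Rightarrow> int" where
  "sign_changes I i = (if \<bar>i\<bar> \<in> I then - i else i)"

definition hyp_of_perm :: "(int \<Rightarrow> int) \<Rightarrow> int \<Rightarrow> int" where
  "hyp_of_perm \<pi> i = sgn i * \<pi> \<bar>i\<bar>"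


lemma hyperoct_bij: "\<sigma> \<in> hyperoct r \<Longrightarrow> bij \<sigma>"
  by (auto simp: hyperoct_def intro: permutes_bij)

lemma hyperoct_0: "\<sigma> \<in> hyperoct r \<Longrightarrow> \<sigma> 0 = 0"
  by (auto simp: hyperoct_def symbols_def permutes_def)

lemma hyperoct_inv: assumes "\<sigma> \<in> hyperoct r" shows "inv \<sigma> \<in> hyperoct r"
proof -
  have b: "bij \<sigma>" and m: "\<And>i. \<sigma> (- i) = - \<sigma> i" and p: "\<sigma> permutes symbols r"
    using assms hyperoct_bij by (auto simp: hyperoct_def)
  have "inv \<sigma> (- i) = - inv \<sigma> i" for i
    by (metis b m bij_inv_eq_iff)
  then show ?thesis using permutes_inv[OF p] by (auto simp: hyperoct_def)
qed

lemma hyperoct_comp: "\<sigma> \<in> hyperoct r \<Longrightarrow> \<tau> \<in> hyperoct r \<Longrightarrow> \<tau> \<circ> \<sigma> \<in> hyperoct r"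
  by (auto simp: hyperoct_def intro: permutes_compose)

lemma hyperoct_abs: assumes "\<sigma> \<in> hyperoct r" shows "\<sigma> \<bar>i\<bar> = \<sigma> i \<or> \<sigma> \<bar>i\<bar> = - \<sigma> i"
  using assms by (auto simp: hyperoct_def abs_if)

lemma hyperoct_abs_permutes:
  assumes "\<sigma> \<in> hyperoct r"
  shows "restrict_id (\<lambda>i. \<bar>\<sigma> i\<bar>) {1..int r} permutes {1..int r}"
proof (rule permutes_restrict_id)
  have p: "\<sigma> permutes symbols r" and m: "\<And>i. \<sigma> (- i) = - \<sigma> i"
    using assms by (auto simp: hyperoct_def)
  have "inj_on (\<lambda>i. \<bar>\<sigma> i\<bar>) {1..int r}"
  proof (rule inj_onI)
    fix i j assume ij: "i \<in> {1..int r}" "j \<in> {1..int r}" "\<bar>\<sigma> i\<bar> = \<bar>\<sigma> j\<bar>"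
    then have "\<sigma> i = \<sigma> j \<or> \<sigma> i = \<sigma> (- j)" by (auto simp: m abs_eq_iff)
    then have "i = j \<or> i = - j" using permutes_inj[OF p] by (auto dest: injD)
    then show "i = j" using ij by auto
  qed
  moreover have "(\<lambda>i. \<bar>\<sigma> i\<bar>) ` {1..int r} \<subseteq> {1..int r}"
  proof
    fix x assume "x \<in> (\<lambda>i. \<bar>\<sigma> i\<bar>) ` {1..int r}"
    then obtain i where i: "i \<in> {1..int r}" "x = \<bar>\<sigma> i\<bar>" by auto
    then have "\<sigma> i \<in> symbols r" using permutes_in_image[OF p, of i] by (auto simp: symbols_def)
    then show "x \<in> {1..int r}" using i by (auto simp: symbols_def)
  qed
  ultimately show "bij_betw (\<lambda>i. \<bar>\<sigma> i\<bar>) {1..int r} {1..int r}"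
    by (simp add: bij_betw_def endo_inj_surj)
qed

lemma hyperoct_decompose:
  assumes "\<sigma> \<in> hyperoct r"
  shows "\<sigma> = hyp_of_perm (restrict_id (\<lambda>i. \<bar>\<sigma> i\<bar>) {1..int r}) \<circ>
              sign_changes {i \<in> {1..int r}. \<sigma> i < 0}"
proof
  fix i
  have p: "\<sigma> permutes symbols r" and m: "\<And>i. \<sigma> (- i) = - \<sigma> i"
    using assms by (auto simp: hyperoct_def)
  have z: "\<sigma> j = j" if "j \<notin> symbols r" for j
    using p that by (auto simp: permutes_def)
  have nz: "\<sigma> j \<noteq> 0" if "j \<noteq> 0" for j
    using that hyperoct_0[OF assms] permutes_inj[OF p] by (metis injD)
  show "\<sigma> i = (hyp_of_perm (restrict_id (\<lambda>i. \<bar>\<sigma> i\<bar>) {1..int r}) \<circ>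
              sign_changes {i \<in> {1..int r}. \<sigma> i < 0}) i"
  proof (cases "i \<in> symbols r")
    case False
    then show ?thesis
      using z[of i] hyperoct_0[OF assms]
      by (cases "i = 0") (auto simp: hyp_of_perm_def sign_changes_def restrict_id_def symbols_def
          sgn_mult_abs)
  next
    case True
    then have "i < 0 \<or> i > 0" "\<bar>i\<bar> \<in> {1..int r}"
      by (auto simp: symbols_def)
    moreover have "\<sigma> i < 0 \<or> \<sigma> i > 0"
      using nz[of i] calculation(1) by linarith
    ultimately show ?thesis
      using m[of i] by (elim disjE) (simp_all add: hyp_of_perm_def sign_changes_def restrict_id_def)
  qed
qed

lemma hyp_sgn_decompose:
  assumes pi: "\<pi> permutes {1..int r}" and I: "I \<subseteq> {1..int r}"
  shows "hyp_sgn r (hyp_of_perm \<pi> \<circ> sign_changes I) = (- 1) ^ card I * sign \<pi>"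
proof -
  let ?s = "hyp_of_perm \<pi> \<circ> sign_changes I"
  have pos: "\<pi> i \<ge> 1" if "i \<in> {1..int r}" for i
    using permutes_in_image[OF pi, of i] that by auto
  have e: "?s i = (if i \<in> I then - \<pi> i else \<pi> i)" if "i \<in> {1..int r}" for i
    using that by (auto simp: hyp_of_perm_def sign_changes_def)
  have "{i \<in> {1..int r}. ?s i < 0} = I"
  proof (rule set_eqI)
    fix i
    show "i \<in> {i \<in> {1..int r}. ?s i < 0} \<longleftrightarrow> i \<in> I"
      using I e[of i] pos[of i] by (cases "i \<in> {1..int r}"; cases "i \<in> I") auto
  qed
  moreover have "sign_on {1..int r} (\<lambda>i. \<bar>?s i\<bar>) = sign_on {1..int r} \<pi>"
  proof (rule sign_on_cong)
    fix i assume "i \<in> {1..int r}"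
    then show "\<bar>?s i\<bar> = \<pi> i" using e[of i] pos[of i] by (cases "i \<in> I") simp_all
  qed simp
  ultimately show ?thesis
    unfolding hyp_sgn_def using sign_on_permutes[OF pi order_refl] by simp
qed


section \<open>Partitions, bi-partitions, bi-tableaux and bi-tabloids\<close>

type_synonym bipart = "nat list \<times> nat list"
type_synonym box = "nat \<times> nat"
type_synonym bitableau = "box + box \<Rightarrow> int"
type_synonym bitabloid = "bitableau set"

definition is_partition :: "nat list \<Rightarrow> bool" where
  "is_partition \<mu> \<longleftrightarrow> sorted_wrt (\<ge>) \<mu> \<and> 0 \<notin> set \<mu>"

definition is_bipartition :: "nat \<Rightarrow> bipart \<Rightarrow> bool" where
  "is_bipartition r lam \<longleftrightarrow>
     is_partition (fst lam) \<and> is_partition (snd lam) \<and> sum_list (fst lam) + sum_list (snd lam) = r"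

definition conjugate :: "nat list \<Rightarrow> nat list" where
  "conjugate \<mu> = map (\<lambda>j. length (filter (\<lambda>k. j < k) \<mu>)) [0..<(if \<mu> = [] then 0 else hd \<mu>)]"

definition biconjugate :: "bipart \<Rightarrow> bipart" where
  "biconjugate lam = (conjugate (snd lam), conjugate (fst lam))"

text \<open>Rows and columns are numbered from 0: the box \<open>(i, j)\<close> is in row \<open>i\<close> and column \<open>j\<close>.\<close>

definition diagram :: "nat list \<Rightarrow> box set" where
  "diagram \<mu> = {(i, j). i < length \<mu> \<and> j < \<mu> ! i}"

definition bidiagram :: "bipart \<Rightarrow> (box + box) set" where
  "bidiagram lam = diagram (fst lam) <+> diagram (snd lam)"

text \<open>
  A bi-tableau \<open>t = (t\<^sup>1, t\<^sup>2)\<close> is a function on the disjoint union of the two diagrams: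
  \<open>t\<^sup>1 = t \<circ> Inl\<close> and \<open>t\<^sup>2 = t \<circ> Inr\<close>.  Outside the diagrams it takes the value 0, which is
  not a symbol and is fixed by the hyperoctahedral group.
\<close>

definition bitableaux :: "nat \<Rightarrow> bipart \<Rightarrow> bitableau set" where
  "bitableaux r lam = {t. bij_betw (\<lambda>b. \<bar>t b\<bar>) (bidiagram lam) {1..int r} \<and>
                         (\<forall>b. b \<notin> bidiagram lam \<longrightarrow> t b = 0)}"

definition tableau_act :: "bitableau \<Rightarrow> (int \<Rightarrow> int) \<Rightarrow> bitableau" where
  "tableau_act t \<sigma> = \<sigma> \<circ> t"

text \<open>Rows and columns as sets of entries; 1 and 2 refer to the components \<open>t\<^sup>1\<close> and \<open>t\<^sup>2\<close>.\<close>

definition row1 :: "bipart \<Rightarrow> bitableau \<Rightarrow> nat \<Rightarrow> int set" where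
  "row1 lam t i = {t (Inl (i, j)) |j. (i, j) \<in> diagram (fst lam)}"

definition row2 :: "bipart \<Rightarrow> bitableau \<Rightarrow> nat \<Rightarrow> int set" where
  "row2 lam t i = {t (Inr (i, j)) |j. (i, j) \<in> diagram (snd lam)}"

definition col1 :: "bipart \<Rightarrow> bitableau \<Rightarrow> nat \<Rightarrow> int set" where
  "col1 lam t j = {t (Inl (i, j)) |i. (i, j) \<in> diagram (fst lam)}"

definition col2 :: "bipart \<Rightarrow> bitableau \<Rightarrow> nat \<Rightarrow> int set" where
  "col2 lam t j = {t (Inr (i, j)) |i. (i, j) \<in> diagram (snd lam)}"

definition plus_minus :: "int set \<Rightarrow> int set" where
  "plus_minus A = A \<union> uminus ` A"

text \<open>
  A permutation of symbols permutes the entries of a row up to changing their signs iff it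
  stabilises the set of all these entries and their negatives.
\<close>

definition row_group :: "nat \<Rightarrow> bipart \<Rightarrow> bitableau \<Rightarrow> (int \<Rightarrow> int) set" where
  "row_group r lam t = {\<sigma> \<in> hyperoct r.
     (\<forall>i. \<sigma> ` row1 lam t i = row1 lam t i) \<and>
     (\<forall>i. \<sigma> ` plus_minus (row2 lam t i) = plus_minus (row2 lam t i))}"

definition col_group :: "nat \<Rightarrow> bipart \<Rightarrow> bitableau \<Rightarrow> (int \<Rightarrow> int) set" where
  "col_group r lam t = {\<sigma> \<in> hyperoct r.
     (\<forall>j. \<sigma> ` plus_minus (col1 lam t j) = plus_minus (col1 lam t j)) \<and>
     (\<forall>j. \<sigma> ` col2 lam t j = col2 lam t j)}"

definition row_equiv :: "nat \<Rightarrow> bipart \<Rightarrow> (bitableau \<times> bitableau) set" where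
  "row_equiv r lam = {(t1, t2). t1 \<in> bitableaux r lam \<and> t2 \<in> bitableaux r lam \<and>
                              (\<exists>\<sigma>\<in>row_group r lam t1. t2 = tableau_act t1 \<sigma>)}"

definition tabloid :: "nat \<Rightarrow> bipart \<Rightarrow> bitableau \<Rightarrow> bitabloid" where
  "tabloid r lam t = row_equiv r lam `` {t}"

definition tabloids :: "nat \<Rightarrow> bipart \<Rightarrow> bitabloid set" where
  "tabloids r lam = bitableaux r lam // row_equiv r lam"

text \<open>On classes, \<open>{t}\<sigma> = {t\<sigma>}\<close>; see \<open>tabloid_act_tabloid\<close> below.\<close>

definition tabloid_act :: "bitabloid \<Rightarrow> (int \<Rightarrow> int) \<Rightarrow> bitabloid" where
  "tabloid_act X \<sigma> = (\<lambda>t. tableau_act t \<sigma>) ` X"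


lemma tableau_act_bitableaux:
  assumes s: "\<sigma> \<in> hyperoct r" and t: "t \<in> bitableaux r lam"
  shows "tableau_act t \<sigma> \<in> bitableaux r lam"
proof -
  have b: "bij_betw (\<lambda>b. \<bar>t b\<bar>) (bidiagram lam) {1..int r}"
    using t by (simp add: bitableaux_def)
  have c: "bij_betw (\<lambda>i. \<bar>\<sigma> i\<bar>) {1..int r} {1..int r}"
    using permutes_imp_bij[OF hyperoct_abs_permutes[OF s]]
    by (rule bij_betw_cong[THEN iffD1, rotated]) (simp add: restrict_id_def)
  have "bij_betw ((\<lambda>i. \<bar>\<sigma> i\<bar>) \<circ> (\<lambda>b. \<bar>t b\<bar>)) (bidiagram lam) {1..int r}"
    using b c by (rule bij_betw_trans)
  moreover have "((\<lambda>i. \<bar>\<sigma> i\<bar>) \<circ> (\<lambda>b. \<bar>t b\<bar>)) = (\<lambda>b. \<bar>tableau_act t \<sigma> b\<bar>)"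
  proof
    fix b
    show "((\<lambda>i. \<bar>\<sigma> i\<bar>) \<circ> (\<lambda>b. \<bar>t b\<bar>)) b = \<bar>tableau_act t \<sigma> b\<bar>"
      using hyperoct_abs[OF s, of "t b"] by (auto simp: tableau_act_def)
  qed
  ultimately show ?thesis
    using t hyperoct_0[OF s] by (simp add: bitableaux_def tableau_act_def)
qed

lemma row_group_tableau_act:
  assumes s: "\<sigma> \<in> hyperoct r" and rho: "\<rho> \<in> row_group r lam t"
  shows "\<sigma> \<circ> \<rho> \<circ> inv \<sigma> \<in> row_group r lam (tableau_act t \<sigma>)"
proof -
  have inj: "inj \<sigma>" and m: "\<And>i. \<sigma> (- i) = - \<sigma> i"
    using hyperoct_bij[OF s] s by (auto simp: bij_def hyperoct_def)
  have 1: "row1 lam (tableau_act t \<sigma>) i = \<sigma> ` row1 lam t i"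
       "row2 lam (tableau_act t \<sigma>) i = \<sigma> ` row2 lam t i" for i
    by (auto simp: row1_def row2_def tableau_act_def)
  have 2: "plus_minus (\<sigma> ` A) = \<sigma> ` plus_minus A" for A
    by (auto simp: plus_minus_def image_Un image_image m)
  have 3: "(\<sigma> \<circ> \<rho> \<circ> inv \<sigma>) ` \<sigma> ` A = \<sigma> ` \<rho> ` A" for A
    using inj by (simp add: image_image)
  have "\<sigma> \<circ> \<rho> \<circ> inv \<sigma> \<in> hyperoct r"
    using s rho by (auto simp: row_group_def intro!: hyperoct_comp hyperoct_inv)
  then show ?thesis
    using rho unfolding row_group_def mem_Collect_eq 1 2 3 by simp
qed

lemma tableau_act_comp: "tableau_act (tableau_act t \<sigma>) \<tau> = tableau_act t (\<tau> \<circ> \<sigma>)"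
  by (simp add: tableau_act_def o_assoc)

lemma row_equiv_tableau_act:
  assumes s: "\<sigma> \<in> hyperoct r" and "(t, u) \<in> row_equiv r lam"
  shows "(tableau_act t \<sigma>, tableau_act u \<sigma>) \<in> row_equiv r lam"
proof -
  obtain \<rho> where tu: "t \<in> bitableaux r lam" "u \<in> bitableaux r lam"
    and rho: "\<rho> \<in> row_group r lam t" and u: "u = tableau_act t \<rho>"
    using assms(2) by (auto simp: row_equiv_def)
  have "tableau_act u \<sigma> = tableau_act (tableau_act t \<sigma>) (\<sigma> \<circ> \<rho> \<circ> inv \<sigma>)"
    using hyperoct_bij[OF s] by (auto simp: u tableau_act_def fun_eq_iff bij_def)
  then show ?thesis
    using row_group_tableau_act[OF s rho] tableau_act_bitableaux[OF s tu(1)]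
      tableau_act_bitableaux[OF s tu(2)]
    unfolding row_equiv_def by blast
qed

lemma tabloid_act_tabloid:
  assumes s: "\<sigma> \<in> hyperoct r"
  shows "tabloid_act (tabloid r lam t) \<sigma> = tabloid r lam (tableau_act t \<sigma>)"
proof
  show "tabloid_act (tabloid r lam t) \<sigma> \<subseteq> tabloid r lam (tableau_act t \<sigma>)"
    unfolding tabloid_act_def tabloid_def using row_equiv_tableau_act[OF s] by blast
  have b: "bij \<sigma>" by (rule hyperoct_bij[OF s])
  show "tabloid r lam (tableau_act t \<sigma>) \<subseteq> tabloid_act (tabloid r lam t) \<sigma>"
  proof
    fix u assume "u \<in> tabloid r lam (tableau_act t \<sigma>)"
    then have "(tableau_act (tableau_act t \<sigma>) (inv \<sigma>), tableau_act u (inv \<sigma>)) \<in> row_equiv r lam"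
      unfolding tabloid_def using row_equiv_tableau_act[OF hyperoct_inv[OF s]] by blast
    moreover have "tableau_act (tableau_act t \<sigma>) (inv \<sigma>) = t"
      using b by (auto simp: tableau_act_def fun_eq_iff bij_def)
    moreover have "u = tableau_act (tableau_act u (inv \<sigma>)) \<sigma>"
      using b by (auto simp: tableau_act_def fun_eq_iff bij_def surj_f_inv_f)
    ultimately show "u \<in> tabloid_act (tabloid r lam t) \<sigma>"
      by (auto simp: tabloid_act_def tabloid_def)
  qed
qed

lemma equiv_row_equiv: "equiv (bitableaux r lam) (row_equiv r lam)"
proof (rule equivI)
  show "row_equiv r lam \<subseteq> bitableaux r lam \<times> bitableaux r lam"
    unfolding row_equiv_def by blast
  have id: "id \<in> row_group r lam t" for t
    by (auto simp: row_group_def hyperoct_def permutes_id)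
  show "refl_on (bitableaux r lam) (row_equiv r lam)"
  proof (rule refl_onI)
    fix t assume "t \<in> bitableaux r lam"
    moreover have "t = tableau_act t id" by (simp add: tableau_act_def)
    ultimately show "(t, t) \<in> row_equiv r lam" using id unfolding row_equiv_def by blast
  qed
  have keep: "row_group r lam (tableau_act t \<rho>) = row_group r lam t"
    if "\<rho> \<in> row_group r lam t" for t \<rho>
  proof -
    have m: "\<And>i. \<rho> (- i) = - \<rho> i" using that by (auto simp: row_group_def hyperoct_def)
    have "row1 lam (tableau_act t \<rho>) i = \<rho> ` row1 lam t i"
         "row2 lam (tableau_act t \<rho>) i = \<rho> ` row2 lam t i" for i
      by (auto simp: row1_def row2_def tableau_act_def)
    moreover have "plus_minus (\<rho> ` A) = \<rho> ` plus_minus A" for A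
      by (auto simp: plus_minus_def image_Un image_image m)
    ultimately show ?thesis using that by (simp add: row_group_def)
  qed
  have grp_inv: "inv \<rho> \<in> row_group r lam t" if "\<rho> \<in> row_group r lam t" for t \<rho>
  proof -
    have h: "\<rho> \<in> hyperoct r" using that by (simp add: row_group_def)
    have "inv \<rho> ` A = A" if "\<rho> ` A = A" for A
      using that hyperoct_bij[OF h] by (metis bij_is_inj image_inv_f_f)
    then show ?thesis using that hyperoct_inv[OF h] by (auto simp: row_group_def)
  qed
  have grp_comp: "\<tau> \<circ> \<rho> \<in> row_group r lam t"
    if "\<rho> \<in> row_group r lam t" "\<tau> \<in> row_group r lam t" for t \<rho> \<tau>
  proof -
    have "(\<tau> \<circ> \<rho>) ` A = \<tau> ` \<rho> ` A" for A
      by (simp add: image_comp)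
    then show ?thesis using that hyperoct_comp unfolding row_group_def mem_Collect_eq by metis
  qed
  show "sym (row_equiv r lam)"
  proof (rule symI)
    fix t u assume "(t, u) \<in> row_equiv r lam"
    then obtain \<rho> where tu: "t \<in> bitableaux r lam" "u \<in> bitableaux r lam"
      and rho: "\<rho> \<in> row_group r lam t" and u: "u = tableau_act t \<rho>"
      by (auto simp: row_equiv_def)
    have "t = tableau_act u (inv \<rho>)"
      using rho hyperoct_bij[of \<rho> r]
      by (auto simp: u tableau_act_def fun_eq_iff bij_def row_group_def)
    then show "(u, t) \<in> row_equiv r lam"
      using tu grp_inv[OF rho] keep[OF rho] by (auto simp: row_equiv_def u)
  qed
  show "trans (row_equiv r lam)"
  proof (rule transI)
    fix t u v assume "(t, u) \<in> row_equiv r lam" "(u, v) \<in> row_equiv r lam"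
    then obtain \<rho> \<tau> where tv: "t \<in> bitableaux r lam" "v \<in> bitableaux r lam"
      and rho: "\<rho> \<in> row_group r lam t" and u: "u = tableau_act t \<rho>"
      and tau: "\<tau> \<in> row_group r lam u" and v: "v = tableau_act u \<tau>"
      by (auto simp: row_equiv_def)
    have "\<tau> \<in> row_group r lam t" using tau keep[OF rho] u by simp
    then show "(t, v) \<in> row_equiv r lam"
      using tv grp_comp[OF rho] by (auto simp: row_equiv_def u v tableau_act_comp)
  qed
qed


section \<open>Modules for the group algebra of the hyperoctahedral group\<close>

text \<open>
  A right module over the group algebra is given by its underlying vector space together with
  the right action of the group elements (the action of the group algebra is the linear
  extension).
\<close>

record ('f, 'v) hmod =
  mcarrier :: "'v set"
  madd :: "'v \<Rightarrow> 'v \<Rightarrow> 'v"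
  mscale :: "'f \<Rightarrow> 'v \<Rightarrow> 'v"
  mact :: "'v \<Rightarrow> (int \<Rightarrow> int) \<Rightarrow> 'v"

text \<open>
  An isomorphism of modules over the group algebra: a linear bijection which commutes with the
  action of all group elements, hence with that of the group algebra.
\<close>

definition hmod_iso :: "nat \<Rightarrow> ('f, 'v) hmod \<Rightarrow> ('f, 'w) hmod \<Rightarrow> bool" where
  "hmod_iso r V W \<longleftrightarrow> (\<exists>f. bij_betw f (mcarrier V) (mcarrier W) \<and>
     (\<forall>x\<in>mcarrier V. \<forall>y\<in>mcarrier V. f (madd V x y) = madd W (f x) (f y)) \<and>
     (\<forall>c. \<forall>x\<in>mcarrier V. f (mscale V c x) = mscale W c (f x)) \<and>
     (\<forall>\<sigma>\<in>hyperoct r. \<forall>x\<in>mcarrier V. f (mact V x \<sigma>) = mact W (f x) \<sigma>))"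

definition fscale :: "'f::field \<Rightarrow> ('x \<Rightarrow> 'f) \<Rightarrow> 'x \<Rightarrow> 'f" where
  "fscale c v = (\<lambda>x. c * v x)"

definition single :: "'x \<Rightarrow> 'x \<Rightarrow> 'f::field" where
  "single x = (\<lambda>y. if y = x then 1 else 0)"

global_interpretation fun_space: vector_space "fscale :: 'f::field \<Rightarrow> ('x \<Rightarrow> 'f) \<Rightarrow> 'x \<Rightarrow> 'f"
  by unfold_locales (auto simp: fscale_def fun_eq_iff algebra_simps)


subsection \<open>Permutation modules and Specht modules\<close>

text \<open>
  The basis vector of the bi-tabloid \<open>X\<close> is \<open>single X\<close>, and it is sent by \<open>\<sigma>\<close> to
  \<open>single (tabloid_act X \<sigma>)\<close>; see \<open>perm_act_single\<close> below.
\<close>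

definition perm_act :: "(bitabloid \<Rightarrow> 'f) \<Rightarrow> (int \<Rightarrow> int) \<Rightarrow> bitabloid \<Rightarrow> 'f" where
  "perm_act v \<sigma> = (\<lambda>X. v (tabloid_act X (inv \<sigma>)))"

lemma perm_act_single:
  assumes s: "\<sigma> \<in> hyperoct r"
  shows "perm_act (single X) \<sigma> = (single (tabloid_act X \<sigma>) :: _ \<Rightarrow> 'f::field)"
proof -
  have i: "inv \<sigma> (\<sigma> j) = j" "\<sigma> (inv \<sigma> j) = j" for j
    using hyperoct_bij[OF s] by (auto simp: bij_is_inj bij_is_surj surj_f_inv_f)
  have "tabloid_act Y (inv \<sigma>) = X \<longleftrightarrow> Y = tabloid_act X \<sigma>" for Y
  proof -
    have "tabloid_act (tabloid_act Y (inv \<sigma>)) \<sigma> = Y" "tabloid_act (tabloid_act X \<sigma>) (inv \<sigma>) = X"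
      using i by (simp_all add: tabloid_act_def image_image tableau_act_def comp_def)
    then show ?thesis by metis
  qed
  then show ?thesis unfolding perm_act_def single_def by simp
qed

definition perm_module :: "nat \<Rightarrow> bipart \<Rightarrow> ('f::field, bitabloid \<Rightarrow> 'f) hmod" where
  "perm_module r lam = \<lparr>mcarrier = {v. \<forall>X. X \<notin> tabloids r lam \<longrightarrow> v X = 0},
                      madd = (+), mscale = fscale, mact = perm_act\<rparr>"

text \<open>Elements of the group algebra are given by their coefficient functions.\<close>

definition perm_alg_act ::
    "nat \<Rightarrow> (bitabloid \<Rightarrow> 'f::field) \<Rightarrow> ((int \<Rightarrow> int) \<Rightarrow> 'f) \<Rightarrow> bitabloid \<Rightarrow> 'f" where
  "perm_alg_act r v a = (\<Sum>\<sigma>\<in>hyperoct r. fscale (a \<sigma>) (perm_act v \<sigma>))"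

definition col_antisym :: "nat \<Rightarrow> bipart \<Rightarrow> bitableau \<Rightarrow> (int \<Rightarrow> int) \<Rightarrow> 'f::field" where
  "col_antisym r lam t = (\<lambda>\<sigma>. if \<sigma> \<in> col_group r lam t then of_int (hyp_sgn r \<sigma>) else 0)"

definition polytabloid :: "nat \<Rightarrow> bipart \<Rightarrow> bitableau \<Rightarrow> bitabloid \<Rightarrow> 'f::field" where
  "polytabloid r lam t = perm_alg_act r (single (tabloid r lam t)) (col_antisym r lam t)"

definition specht :: "nat \<Rightarrow> bipart \<Rightarrow> ('f::field, bitabloid \<Rightarrow> 'f) hmod" where
  "specht r lam = (perm_module r lam)
     \<lparr>mcarrier := fun_space.span (polytabloid r lam ` bitableaux r lam)\<rparr>"


subsection \<open>Contragredient dual and tensor product\<close>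

text \<open>Linear forms on \<open>V\<close> are extended by 0 outside the carrier, to make them unique.\<close>

definition dual :: "('f::field, 'v) hmod \<Rightarrow> ('f, 'v \<Rightarrow> 'f) hmod" where
  "dual V = \<lparr>
     mcarrier = {\<phi>. (\<forall>x. x \<notin> mcarrier V \<longrightarrow> \<phi> x = 0) \<and>
       (\<forall>x\<in>mcarrier V. \<forall>y\<in>mcarrier V. \<phi> (madd V x y) = \<phi> x + \<phi> y) \<and>
       (\<forall>c. \<forall>x\<in>mcarrier V. \<phi> (mscale V c x) = c * \<phi> x)},
     madd = (+),
     mscale = fscale,
     mact = (\<lambda>\<phi> \<sigma> x. if x \<in> mcarrier V then \<phi> (mact V x (inv \<sigma>)) else 0)\<rparr>"

definition dual_specht :: "nat \<Rightarrow> bipart \<Rightarrow> ('f::field, (bitabloid \<Rightarrow> 'f) \<Rightarrow> 'f) hmod" where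
  "dual_specht r lam = dual (specht r lam)"

text \<open>
  The tensor product of \<open>V\<close> and \<open>W\<close> is the free vector space on \<open>V \<times> W\<close> (finitely supported
  functions, with basis the functions \<open>single (v, w)\<close>) modulo the bilinearity relations; its
  elements are cosets, and \<open>v \<otimes> w\<close> is the coset of \<open>single (v, w)\<close>.
\<close>

definition free_on :: "'x set \<Rightarrow> ('x \<Rightarrow> 'f::field) set" where
  "free_on A = {u. finite {x. u x \<noteq> 0} \<and> {x. u x \<noteq> 0} \<subseteq> A}"

definition bilin_rels :: "('f::field, 'v) hmod \<Rightarrow> ('f, 'w) hmod \<Rightarrow> ('v \<times> 'w \<Rightarrow> 'f) set" where
  "bilin_rels V W = fun_space.span (
     {single (madd V x y, w) - single (x, w) - single (y, w) |x y w.
        x \<in> mcarrier V \<and> y \<in> mcarrier V \<and> w \<in> mcarrier W} \<union>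
     {single (v, madd W x y) - single (v, x) - single (v, y) |v x y.
        v \<in> mcarrier V \<and> x \<in> mcarrier W \<and> y \<in> mcarrier W} \<union>
     {single (mscale V c v, w) - fscale c (single (v, w)) |c v w.
        v \<in> mcarrier V \<and> w \<in> mcarrier W} \<union>
     {single (v, mscale W c w) - fscale c (single (v, w)) |c v w.
        v \<in> mcarrier V \<and> w \<in> mcarrier W})"

text \<open>The linear map of free spaces given on the basis by \<open>(v, w) \<mapsto> (v\<sigma>, w\<sigma>)\<close>.\<close>

definition free_act ::
    "('f::field, 'v) hmod \<Rightarrow> ('f, 'w) hmod \<Rightarrow> ('v \<times> 'w \<Rightarrow> 'f) \<Rightarrow> (int \<Rightarrow> int) \<Rightarrow> 'v \<times> 'w \<Rightarrow> 'f" where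
  "free_act V W u \<sigma> = (\<Sum>(v, w) | u (v, w) \<noteq> 0. fscale (u (v, w)) (single (mact V v \<sigma>, mact W w \<sigma>)))"

definition tensor :: "('f::field, 'v) hmod \<Rightarrow> ('f, 'w) hmod \<Rightarrow> ('f, ('v \<times> 'w \<Rightarrow> 'f) set) hmod" where
  "tensor V W = \<lparr>
     mcarrier = {u +o bilin_rels V W |u. u \<in> free_on (mcarrier V \<times> mcarrier W)},
     madd = (\<lambda>A B. {a + b |a b. a \<in> A \<and> b \<in> B}),
     mscale = (\<lambda>c A. {fscale c a + n |a n. a \<in> A \<and> n \<in> bilin_rels V W}),
     mact = (\<lambda>A \<sigma>. {free_act V W a \<sigma> + n |a n. a \<in> A \<and> n \<in> bilin_rels V W})\<rparr>"

end

theory Submission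
  imports Defs
begin

text \<open>
  Let \<open>t\<close> and \<open>u\<close> be \<open>\<lambda>\<close>-bi-tableaux.  The coefficient of the bi-tabloid \<open>{u}\<close> in \<open>e\<^sub>t\<close> is the
  number of pairs \<open>\<gamma> \<in> C\<^sub>t\<close>, \<open>\<rho> \<in> R\<^sub>u\<close> with \<open>t\<gamma> = u\<rho>\<close>, counted with the sign of \<open>\<gamma>\<close>.  Write \<open>t'\<close> for
  the transposed bi-tableau, of shape \<open>\<lambda>'\<close>.  Transposition exchanges row groups and column groups,
  so the coefficient of \<open>{t'}\<close> in \<open>e\<^bsub>u'\<^esub>\<close> counts the same pairs, now with the sign of \<open>\<rho>\<close>.  The
  two signs differ by the sign of the group element that takes \<open>t\<close> to \<open>u\<close>, which is a product of a
  sign of \<open>t\<close> and a sign of \<open>u\<close> (\<open>polytabloid_transpose\<close>, \<open>tableau_sign_act\<close>).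

  Hence, up to signs of rows and columns, one matrix, indexed by bi-tableaux, has the elements
  \<open>e\<^sub>t\<close> of \<open>S(\<lambda>)\<close> as its rows and the elements \<open>e\<^bsub>u'\<^esub>\<close> of \<open>S(\<lambda>')\<close> as its columns.  Over every field
  the row space and the column space of a matrix are dual to each other
  (\<open>dual_row_space_eq_column_space\<close>); neither the dimension nor the characteristic enters.  The
  signs of the rows turn the action on \<open>S(\<lambda>)\<close> into its twist by the sign character
  (\<open>dual_specht_iso_sign_twist\<close>), and twisting is the same as tensoring with the sign module
  (\<open>sign_twist_iso_tensor\<close>, \<open>sign_module\<close>).
\<close>

section \<open>Linear forms on spaces of functions\<close>

lemma sum_fun_apply: "(\<Sum>i\<in>I. f i) x = (\<Sum>i\<in>I. f i x)"
  for f :: "'i \<Rightarrow> 'x \<Rightarrow> 'f::comm_monoid_add"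
  by (induction I rule: infinite_finite_induct) auto

lemma fscale_simps [simp]:
  "fscale 1 v = v" "fscale 0 v = 0" "fscale c 0 = 0"
  "fscale a (fscale b v) = fscale (a * b) v"
  by (auto simp: fscale_def fun_eq_iff)

lemma fscale_apply: "fscale c v x = c * v x"
  by (simp add: fscale_def)

lemma expand_in_singles:
  assumes "finite X" "\<And>x. x \<notin> X \<Longrightarrow> v x = 0"
  shows "v = (\<Sum>x\<in>X. fscale (v x) (single x))"
proof
  fix y
  have "(\<Sum>x\<in>X. fscale (v x) (single x)) y = (\<Sum>x\<in>X. if y = x then v x else 0)"
    by (auto simp: sum_fun_apply fscale_def single_def intro!: sum.cong)
  also have "\<dots> = v y"
    using assms by (cases "y \<in> X") auto
  finally show "v y = (\<Sum>x\<in>X. fscale (v x) (single x)) y" by simp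
qed

lemma span_fun_induct [consumes 1, case_names base step]:
  fixes B :: "('x \<Rightarrow> 'f::field) set"
  assumes "v \<in> fun_space.span B" and "P 0"
    and "\<And>c b w. b \<in> B \<Longrightarrow> w \<in> fun_space.span B \<Longrightarrow> P w \<Longrightarrow> P (fscale c b + w)"
  shows "P v"
proof -
  have "v \<in> fun_space.span B \<and> P v"
    by (rule fun_space.span_induct_alt[where h = "\<lambda>v. v \<in> fun_space.span B \<and> P v", OF assms(1)])
      (auto simp: assms fun_space.span_zero fun_space.span_add fun_space.span_scale fun_space.span_base)
  then show ?thesis by simp
qed

lemma span_vanishing:
  assumes "v \<in> fun_space.span B" "\<And>b. b \<in> B \<Longrightarrow> b x = 0"
  shows "v x = 0"
  using assms(1)
  by (induction rule: span_fun_induct) (auto simp: fscale_def assms(2))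

text \<open>
  A linear form on a subspace of \<open>F\<^sup>X\<close> extends to \<open>F\<^sup>X\<close>, where it is a combination of the
  evaluations at the points of \<open>X\<close>.
\<close>

lemma linear_form_eq_evaluations:
  fixes \<phi> :: "('x \<Rightarrow> 'f::field) \<Rightarrow> 'f"
  assumes X: "finite X" "\<And>b x. b \<in> B \<Longrightarrow> x \<notin> X \<Longrightarrow> b x = 0"
    and add: "\<And>v w. v \<in> fun_space.span B \<Longrightarrow> w \<in> fun_space.span B \<Longrightarrow> \<phi> (v + w) = \<phi> v + \<phi> w"
    and scale: "\<And>c v. v \<in> fun_space.span B \<Longrightarrow> \<phi> (fscale c v) = c * \<phi> v"
  obtains c where "\<And>v. v \<in> fun_space.span B \<Longrightarrow> \<phi> v = (\<Sum>x\<in>X. c x * v x)"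
proof -
  interpret forms: vector_space_pair "fscale :: 'f \<Rightarrow> ('x \<Rightarrow> 'f) \<Rightarrow> _" "(*) :: 'f \<Rightarrow> 'f \<Rightarrow> 'f"
    by unfold_locales (auto simp: algebra_simps)
  obtain A where A: "A \<subseteq> B" "fun_space.independent A" "B \<subseteq> fun_space.span A"
    using fun_space.maximal_independent_subset by blast
  obtain g where g: "Vector_Spaces.linear fscale (*) g" "\<And>a. a \<in> A \<Longrightarrow> g a = \<phi> a"
    using forms.linear_independent_extend[OF A(2)] by blast
  interpret g: Vector_Spaces.linear fscale "(*)" g by (rule g(1))
  have zero: "\<phi> 0 = 0"
    using scale[of 0 0] by (simp add: fun_space.span_zero)
  have eq: "\<phi> v = g v" if "v \<in> fun_space.span B" for v
  proof -
    have "v \<in> fun_space.span A"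
      using that A(3) fun_space.span_minimal fun_space.subspace_span by blast
    then show ?thesis
    proof (induction rule: span_fun_induct)
      case base
      show ?case using zero g.zero by metis
    next
      case (step c x y)
      then have "x \<in> fun_space.span B" "y \<in> fun_space.span B"
        using A(1) fun_space.span_base fun_space.span_mono by blast+
      then have "\<phi> (fscale c x + y) = g (fscale c x + y)"
        using step g(2) by (simp add: add scale fun_space.span_scale g.add g.scale)
      then show ?case .
    qed
  qed
  show thesis
  proof (rule that[of "\<lambda>x. g (single x)"])
    fix v assume v: "v \<in> fun_space.span B"
    have "v = (\<Sum>x\<in>X. fscale (v x) (single x))"
      using X span_vanishing[OF v] by (intro expand_in_singles) auto
    then have "g v = g (\<Sum>x\<in>X. fscale (v x) (single x))" by simp
    also have "\<dots> = (\<Sum>x\<in>X. g (single x) * v x)"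
      by (simp add: g.sum g.scale mult.commute)
    finally show "\<phi> v = (\<Sum>x\<in>X. g (single x) * v x)" using eq[OF v] by simp
  qed
qed

text \<open>
  The row space and the column space of a matrix are dual to each other: a linear form on the
  span of the rows \<open>e u\<close> is determined by its values on the rows, and the vectors of values that
  occur are the combinations of columns.  This replaces any comparison of dimensions.
\<close>

lemma dual_row_space_eq_column_space:
  fixes e :: "'u \<Rightarrow> 'x \<Rightarrow> 'f::field" and V :: "('f, 'x \<Rightarrow> 'f) hmod"
  assumes X: "finite X" "\<And>u x. u \<in> U \<Longrightarrow> x \<notin> X \<Longrightarrow> e u x = 0"
    and V: "mcarrier V = fun_space.span (e ` U)" "madd V = (+)" "mscale V = fscale"
  shows "bij_betw (\<lambda>\<phi> u. if u \<in> U then \<phi> (e u) else 0) (mcarrier (dual V))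
           (fun_space.span ((\<lambda>x u. if u \<in> U then e u x else 0) ` X))"
proof -
  let ?D = "\<lambda>\<phi> u. if u \<in> U then \<phi> (e u) else 0"
  let ?col = "\<lambda>x u. if u \<in> U then e u x else 0"
  let ?S = "fun_space.span (e ` U)"
  have dual: "\<phi> \<in> mcarrier (dual V) \<longleftrightarrow> (\<forall>v. v \<notin> ?S \<longrightarrow> \<phi> v = 0) \<and>
      (\<forall>v\<in>?S. \<forall>w\<in>?S. \<phi> (v + w) = \<phi> v + \<phi> w) \<and> (\<forall>c. \<forall>v\<in>?S. \<phi> (fscale c v) = c * \<phi> v)" for \<phi>
    by (simp add: dual_def V)
  have eU: "e u \<in> ?S" if "u \<in> U" for u
    using that by (simp add: fun_space.span_base)
  have comb: "?D \<phi> = (\<Sum>x\<in>X. fscale (c x) (?col x))"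
    if "\<And>v. v \<in> ?S \<Longrightarrow> \<phi> v = (\<Sum>x\<in>X. c x * v x)" for \<phi> c
    by (auto simp: fun_eq_iff sum_fun_apply fscale_def that eU)
  have "inj_on ?D (mcarrier (dual V))"
  proof (rule inj_onI)
    fix \<phi> \<psi> assume pp: "\<phi> \<in> mcarrier (dual V)" "\<psi> \<in> mcarrier (dual V)" "?D \<phi> = ?D \<psi>"
    have e: "\<phi> (e u) = \<psi> (e u)" if "u \<in> U" for u
      using fun_cong[OF pp(3), of u] that by simp
    have "\<phi> v = \<psi> v" for v
    proof (cases "v \<in> ?S")
      case False then show ?thesis using pp dual by metis
    next
      case True
      then show ?thesis
      proof (induction rule: span_fun_induct)
        case base
        have "\<phi> (fscale 0 0) = 0 * \<phi> 0" "\<psi> (fscale 0 0) = 0 * \<psi> 0"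
          using pp(1,2) dual fun_space.span_zero by blast+
        then have "\<phi> 0 = \<psi> 0" by simp
        then show ?case .
      next
        case (step c x y)
        have x: "x \<in> ?S" using step fun_space.span_base by blast
        have "\<phi> (fscale c x + y) = c * \<phi> x + \<phi> y" "\<psi> (fscale c x + y) = c * \<psi> x + \<psi> y"
          using pp(1,2) step x fun_space.span_scale[OF x, of c] unfolding dual by metis+
        then have "\<phi> (fscale c x + y) = \<psi> (fscale c x + y)"
          using step e by auto
        then show ?case .
      qed
    qed
    then show "\<phi> = \<psi>" by blast
  qed
  moreover have "?D ` mcarrier (dual V) = fun_space.span (?col ` X)"
  proof (intro equalityI subsetI)
    fix w assume "w \<in> ?D ` mcarrier (dual V)"
    then obtain \<phi> where \<phi>: "\<phi> \<in> mcarrier (dual V)" "w = ?D \<phi>" by blast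
    obtain c where "\<And>v. v \<in> ?S \<Longrightarrow> \<phi> v = (\<Sum>x\<in>X. c x * v x)"
      using linear_form_eq_evaluations[of X "e ` U" \<phi>] X \<phi>(1) unfolding dual by blast
    then have "w = (\<Sum>x\<in>X. fscale (c x) (?col x))" using comb \<phi>(2) by blast
    then show "w \<in> fun_space.span (?col ` X)"
      by (simp add: fun_space.span_sum fun_space.span_scale fun_space.span_base)
  next
    fix w assume "w \<in> fun_space.span (?col ` X)"
    then have "\<exists>c. w = (\<Sum>x\<in>X. fscale (c x) (?col x))"
    proof (induction rule: span_fun_induct)
      case base
      show ?case by (rule exI[of _ "\<lambda>_. 0"]) simp
    next
      case (step a v y)
      then obtain c x0 where c: "y = (\<Sum>x\<in>X. fscale (c x) (?col x))" "x0 \<in> X" "v = ?col x0"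
        by blast
      have "fscale a v = (\<Sum>x\<in>X. fscale (if x = x0 then a else 0) (?col x))"
        using c X(1) by (simp add: if_distrib[of "\<lambda>b. fscale b _"] cong: if_cong)
      then have "fscale a v + y = (\<Sum>x\<in>X. fscale ((if x = x0 then a else 0) + c x) (?col x))"
        unfolding c(1) by (simp add: fun_space.scale_left_distrib sum.distrib del: fscale_simps)
      then have "\<exists>c. fscale a v + y = (\<Sum>x\<in>X. fscale (c x) (?col x))"
        by (intro exI[of _ "\<lambda>x. (if x = x0 then a else 0) + c x"])
      then show ?case .
    qed
    then obtain c where c: "w = (\<Sum>x\<in>X. fscale (c x) (?col x))" by blast
    define \<phi> where "\<phi> v = (if v \<in> ?S then \<Sum>x\<in>X. c x * v x else 0)" for v
    have "\<phi> \<in> mcarrier (dual V)"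
      unfolding dual by (auto simp: \<phi>_def fun_space.span_add fun_space.span_scale fscale_apply
          algebra_simps sum.distrib sum_distrib_left)
    moreover have "?D \<phi> = w" unfolding c by (rule comb) (simp add: \<phi>_def)
    ultimately show "w \<in> ?D ` mcarrier (dual V)" by blast
  qed
  ultimately show ?thesis by (simp add: bij_betw_def)
qed

section \<open>Tensor products with a one-dimensional module\<close>

text \<open>
  The linear map that sends \<open>single p\<close> to \<open>g p\<close>.  Over an infinite support the sum defaults to 0, so
  additivity is confined to finitely supported functions.
\<close>

definition lin_ext :: "('p \<Rightarrow> 'x \<Rightarrow> 'f::field) \<Rightarrow> ('p \<Rightarrow> 'f) \<Rightarrow> 'x \<Rightarrow> 'f" where
  "lin_ext g u = (\<Sum>p | u p \<noteq> 0. fscale (u p) (g p))"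

lemma lin_ext_superset:
  assumes "finite P" "{p. u p \<noteq> 0} \<subseteq> P"
  shows "lin_ext g u = (\<Sum>p\<in>P. fscale (u p) (g p))"
  unfolding lin_ext_def using assms by (intro sum.mono_neutral_left) auto

definition finite_support :: "('p \<Rightarrow> 'f::zero) \<Rightarrow> bool" where
  "finite_support u \<longleftrightarrow> finite {p. u p \<noteq> 0}"

lemma finite_support_intros [simp]:
  fixes u v :: "'p \<Rightarrow> 'f::field"
  shows "finite_support (0 :: 'p \<Rightarrow> 'f)"
    and "finite_support (single q :: 'p \<Rightarrow> 'f)"
    and "finite_support u \<Longrightarrow> finite_support v \<Longrightarrow> finite_support (u + v)"
    and "finite_support u \<Longrightarrow> finite_support v \<Longrightarrow> finite_support (u - v)"
    and "finite_support u \<Longrightarrow> finite_support (fscale c u)"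
proof -
  show "finite_support (single q :: 'p \<Rightarrow> 'f)"
    unfolding finite_support_def by (rule finite_subset[of _ "{q}"]) (auto simp: single_def)
  show "finite_support (fscale c u)" if "finite_support u"
    using that unfolding finite_support_def
    by (elim rev_finite_subset) (auto simp: fscale_def)
  have sub: "finite_support w" if "finite_support u" "finite_support v"
    "\<And>p. u p = 0 \<Longrightarrow> v p = 0 \<Longrightarrow> w p = 0" for w :: "'p \<Rightarrow> 'f"
    unfolding finite_support_def
    by (rule finite_subset[of _ "{p. u p \<noteq> 0} \<union> {p. v p \<noteq> 0}"])
      (use that in \<open>auto simp: finite_support_def\<close>)
  show "finite_support (u + v)" "finite_support (u - v)" if "finite_support u" "finite_support v"
    using that by (auto intro: sub)
qed (simp add: finite_support_def)

lemma lin_ext_single [simp]: "lin_ext g (single p) = (g p :: 'x \<Rightarrow> 'f::field)"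
proof -
  have "{q. single p q \<noteq> (0 :: 'f)} = {p}" by (auto simp: single_def)
  then show ?thesis by (simp add: lin_ext_def single_def)
qed

lemma lin_ext_add:
  assumes "finite_support u" "finite_support v"
  shows "lin_ext g (u + v) = lin_ext g u + lin_ext g v"
proof -
  let ?P = "{p. u p \<noteq> 0} \<union> {p. v p \<noteq> 0}"
  have "lin_ext g w = (\<Sum>p\<in>?P. fscale (w p) (g p))" if "{p. w p \<noteq> 0} \<subseteq> ?P" for w
    using assms that by (intro lin_ext_superset) (auto simp: finite_support_def)
  moreover have "{p. (u + v) p \<noteq> 0} \<subseteq> ?P" by auto
  ultimately show ?thesis
    by (simp add: sum.distrib[symmetric] fun_space.scale_left_distrib)
qed

lemma lin_ext_scale: "lin_ext g (fscale c u) = fscale c (lin_ext g u)"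
  by (cases "c = 0") (simp_all add: lin_ext_def fun_space.scale_sum_right fscale_def[of c u])

lemma lin_ext_diff:
  assumes "finite_support u" "finite_support v"
  shows "lin_ext g (u - v) = lin_ext g u - lin_ext g v"
proof -
  have "lin_ext g (u - v) + lin_ext g v = lin_ext g (u - v + v)"
    using assms by (intro lin_ext_add[symmetric]) auto
  then show ?thesis by (simp add: algebra_simps)
qed

text \<open>
  The action on a submodule of a permutation module is restricted from the ambient space of
  functions, so its linearity is stated without membership in the carrier.
\<close>

locale fun_module =
  fixes r :: nat and V :: "('f::field, 'x \<Rightarrow> 'f) hmod"
  assumes subspace: "fun_space.subspace (mcarrier V)"
    and madd: "madd V = (+)"
    and mscale: "mscale V = fscale"
    and act_closed: "\<sigma> \<in> hyperoct r \<Longrightarrow> v \<in> mcarrier V \<Longrightarrow> mact V v \<sigma> \<in> mcarrier V"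
    and act_add: "\<sigma> \<in> hyperoct r \<Longrightarrow> mact V (v + w) \<sigma> = mact V v \<sigma> + mact V w \<sigma>"
    and act_scale: "\<sigma> \<in> hyperoct r \<Longrightarrow> mact V (fscale c v) \<sigma> = fscale c (mact V v \<sigma>)"

text \<open>
  The sign twist has the same underlying space as \<open>V\<close>, which makes it easier to compare with other
  modules than the quotient that defines the tensor product with the sign module.
\<close>

definition sign_twist :: "nat \<Rightarrow> ('f::field, 'x \<Rightarrow> 'f) hmod \<Rightarrow> ('f, 'x \<Rightarrow> 'f) hmod" where
  "sign_twist r V = V\<lparr>mact := \<lambda>v \<sigma>. fscale (of_int (hyp_sgn r \<sigma>)) (mact V v \<sigma>)\<rparr>"

lemma coset_iff: "x \<in> a +o R \<longleftrightarrow> x - a \<in> R" for a :: "'x::ab_group_add"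
  by (force simp: elt_set_plus_def)

lemma coset_eqI:
  assumes "fun_space.subspace R" "a - b \<in> R"
  shows "a +o R = b +o R"
proof -
  have "x - a \<in> R \<longleftrightarrow> x - b \<in> R" for x
    using fun_space.subspace_add[OF assms(1), of "x - a" "a - b"]
      fun_space.subspace_diff[OF assms(1), of "x - b" "a - b"] assms(2) by auto
  then show ?thesis by (auto simp: coset_iff)
qed

lemma coset_eqD:
  assumes "fun_space.subspace R" "a +o R = b +o R"
  shows "a - b \<in> R"
proof -
  have "a \<in> a +o R" using fun_space.subspace_0[OF assms(1)] by (simp add: coset_iff)
  then show ?thesis using assms(2) by (simp add: coset_iff)
qed

text \<open>
  The universal property of the tensor product, for a map that is bilinear modulo \<open>S\<close>.  With
  \<open>S = 0\<close> it yields linear maps out of the tensor product, and with \<open>S\<close> the space of relations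
  it shows that the diagonal action is well defined.
\<close>

lemma lin_ext_bilin_rels:
  assumes S: "fun_space.subspace S"
    and "\<And>x y w. x \<in> mcarrier V \<Longrightarrow> y \<in> mcarrier V \<Longrightarrow> w \<in> mcarrier W \<Longrightarrow>
           g (madd V x y, w) - g (x, w) - g (y, w) \<in> S"
    and "\<And>v x y. v \<in> mcarrier V \<Longrightarrow> x \<in> mcarrier W \<Longrightarrow> y \<in> mcarrier W \<Longrightarrow>
           g (v, madd W x y) - g (v, x) - g (v, y) \<in> S"
    and "\<And>c v w. v \<in> mcarrier V \<Longrightarrow> w \<in> mcarrier W \<Longrightarrow>
           g (mscale V c v, w) - fscale c (g (v, w)) \<in> S"
    and "\<And>c v w. v \<in> mcarrier V \<Longrightarrow> w \<in> mcarrier W \<Longrightarrow>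
           g (v, mscale W c w) - fscale c (g (v, w)) \<in> S"
    and u: "u \<in> bilin_rels V W"
  shows "finite_support u" and "lin_ext g u \<in> S"
proof -
  let ?T = "{u. finite_support u \<and> lin_ext g u \<in> S}"
  have "bilin_rels V W \<subseteq> ?T"
    unfolding bilin_rels_def
  proof (rule fun_space.span_minimal)
    show "fun_space.subspace ?T"
      by (rule fun_space.subspaceI)
        (simp_all add: lin_ext_add lin_ext_scale fun_space.subspace_add[OF S]
          fun_space.subspace_scale[OF S] fun_space.subspace_0[OF S] lin_ext_def[of _ 0])
  qed (auto simp: lin_ext_diff lin_ext_scale assms)
  then show "finite_support u" "lin_ext g u \<in> S" using u by auto
qed

text \<open>
  Every tensor over a one-dimensional second factor \<open>Fs\<close> has the form \<open>v \<otimes> s\<close>, and \<open>v\<close> is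
  recovered from it by the bilinear map \<open>(v, cs) \<mapsto> cv\<close>.
\<close>

lemma sign_twist_iso_tensor:
  fixes V :: "('f::field, 'x \<Rightarrow> 'f) hmod" and W :: "('f, 'y \<Rightarrow> 'f) hmod"
  assumes V: "fun_module r V" and W: "fun_module r W"
    and s: "mcarrier W = fun_space.span {s}" "s \<noteq> 0"
    and s_act: "\<And>\<sigma>. \<sigma> \<in> hyperoct r \<Longrightarrow> mact W s \<sigma> = fscale (of_int (hyp_sgn r \<sigma>)) s"
  shows "hmod_iso r (sign_twist r V) (tensor V W)"
proof -
  interpret V: fun_module r V by (rule V)
  interpret W: fun_module r W by (rule W)
  let ?R = "bilin_rels V W" and ?f = "\<lambda>v. single (v, s) +o bilin_rels V W"
  have R: "fun_space.subspace ?R" by (simp add: bilin_rels_def)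
  note R_add = fun_space.subspace_add[OF R] and R_diff = fun_space.subspace_diff[OF R]
    and R_scale = fun_space.subspace_scale[OF R] and R_0 = fun_space.subspace_0[OF R]
  have sW: "s \<in> mcarrier W" by (simp add: s fun_space.span_base)
  have rel1: "single (x + y, w) - single (x, w) - single (y, w) \<in> ?R"
    if "x \<in> mcarrier V" "y \<in> mcarrier V" "w \<in> mcarrier W" for x y w
    unfolding bilin_rels_def V.madd W.madd by (rule fun_space.span_base) (use that in blast)
  have rel2: "single (v, x + y) - single (v, x) - single (v, y) \<in> ?R"
    if "v \<in> mcarrier V" "x \<in> mcarrier W" "y \<in> mcarrier W" for v x y
    unfolding bilin_rels_def V.madd W.madd by (rule fun_space.span_base) (use that in blast)
  have rel3: "single (fscale c v, w) - fscale c (single (v, w)) \<in> ?R"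
    if "v \<in> mcarrier V" "w \<in> mcarrier W" for c v w
    unfolding bilin_rels_def V.mscale W.mscale by (rule fun_space.span_base) (use that in blast)
  have rel4: "single (v, fscale c w) - fscale c (single (v, w)) \<in> ?R"
    if "v \<in> mcarrier V" "w \<in> mcarrier W" for c v w
    unfolding bilin_rels_def V.mscale W.mscale by (rule fun_space.span_base) (use that in blast)

  (* A value of s that is not zero reads off the coordinate c of an element cs of W, and \<beta> is the
     bilinear map (v, cs) \<mapsto> cv. *)
  obtain x0 where x0: "s x0 \<noteq> 0" using s(2) by (auto simp: fun_eq_iff)
  define \<beta> where "\<beta> = (\<lambda>(v :: 'x \<Rightarrow> 'f, w). fscale (w x0 / s x0) v)"
  have \<beta>_rels: "lin_ext \<beta> u \<in> {0}" if "u \<in> ?R" for u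
  proof (rule lin_ext_bilin_rels(2)[OF _ _ _ _ _ that])
    show "fun_space.subspace {0}" by (rule fun_space.subspace_single_0)
  qed (simp_all add: \<beta>_def V.madd V.mscale W.madd W.mscale fun_space.scale_right_distrib
      fun_space.scale_left_distrib fscale_apply add_divide_distrib mult.commute)
  have inj: "inj_on ?f (mcarrier V)"
  proof (rule inj_onI)
    fix v w assume "?f v = ?f w"
    then have "single (v, s) - single (w, s) \<in> ?R" by (rule coset_eqD[OF R])
    then have "lin_ext \<beta> (single (v, s) - single (w, s)) = 0" using \<beta>_rels by blast
    then have "\<beta> (v, s) - \<beta> (w, s) = 0" by (simp add: lin_ext_diff)
    then show "v = w" using x0 by (simp add: \<beta>_def)
  qed

  have pure: "\<exists>v\<in>mcarrier V. u - single (v, s) \<in> ?R"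
    if u: "u \<in> free_on (mcarrier V \<times> mcarrier W)" for u
  proof -
    let ?Q = "{u. \<exists>v\<in>mcarrier V. u - single (v, s) \<in> ?R}"
    have Q: "fun_space.subspace ?Q"
    proof (rule fun_space.subspaceI)
      have "0 - single (0, s) \<in> ?R"
        using R_diff[OF R_0 rel3[OF fun_space.subspace_0[OF V.subspace] sW, of 0]] by simp
      then show "0 \<in> ?Q" using fun_space.subspace_0[OF V.subspace] by blast
    next
      fix u u' assume "u \<in> ?Q" "u' \<in> ?Q"
      then obtain v v' where v: "v \<in> mcarrier V" "v' \<in> mcarrier V"
        "u - single (v, s) \<in> ?R" "u' - single (v', s) \<in> ?R" by blast
      have "u + u' - single (v + v', s) = (u - single (v, s)) + (u' - single (v', s)) -
          (single (v + v', s) - single (v, s) - single (v', s))"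
        by (simp add: algebra_simps)
      then have "u + u' - single (v + v', s) \<in> ?R"
        using R_diff[OF R_add[OF v(3,4)] rel1[OF v(1,2) sW]] by (simp only:)
      then show "u + u' \<in> ?Q" using fun_space.subspace_add[OF V.subspace v(1,2)] by blast
    next
      fix c u assume "u \<in> ?Q"
      then obtain v where v: "v \<in> mcarrier V" "u - single (v, s) \<in> ?R" by blast
      have "fscale c u - single (fscale c v, s) = fscale c (u - single (v, s)) -
          (single (fscale c v, s) - fscale c (single (v, s)))"
        by (simp add: fun_space.scale_right_diff_distrib)
      then have "fscale c u - single (fscale c v, s) \<in> ?R"
        using R_diff[OF R_scale[OF v(2)] rel3[OF v(1) sW]] by (simp only:)
      then show "fscale c u \<in> ?Q" using fun_space.subspace_scale[OF V.subspace v(1)] by blast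
    qed
    have single: "single p \<in> ?Q" if pVW: "p \<in> mcarrier V \<times> mcarrier W" for p
    proof -
      obtain v c where p: "v \<in> mcarrier V" "p = (v, fscale c s)"
        using pVW unfolding s(1) fun_space.span_singleton by blast
      have "single p - single (fscale c v, s) = (single p - fscale c (single (v, s))) -
          (single (fscale c v, s) - fscale c (single (v, s)))" by simp
      then have "single p - single (fscale c v, s) \<in> ?R"
        using R_diff[OF rel4[OF p(1) sW, of c] rel3[OF p(1) sW, of c]] p(2) by simp
      then show ?thesis using fun_space.subspace_scale[OF V.subspace p(1)] by blast
    qed
    have "u = (\<Sum>p | u p \<noteq> 0. fscale (u p) (single p))"
      using u by (intro expand_in_singles) (auto simp: free_on_def)
    moreover have "\<dots> \<in> ?Q"
      using u single by (intro fun_space.subspace_sum[OF Q] fun_space.subspace_scale[OF Q])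
        (auto simp: free_on_def)
    ultimately show ?thesis by simp
  qed
  have single_free: "single (v, s) \<in> free_on (mcarrier V \<times> mcarrier W)" if "v \<in> mcarrier V" for v
    using that sW by (auto simp: free_on_def single_def)
  have "?f ` mcarrier V = mcarrier (tensor V W)"
  proof (intro equalityI subsetI)
    fix A assume "A \<in> mcarrier (tensor V W)"
    then obtain u where u: "u \<in> free_on (mcarrier V \<times> mcarrier W)" "A = u +o ?R"
      by (auto simp: tensor_def)
    then show "A \<in> ?f ` mcarrier V" using pure[OF u(1)] coset_eqI[OF R] by blast
  qed (use single_free in \<open>auto simp: tensor_def\<close>)
  with inj have bij: "bij_betw ?f (mcarrier V) (mcarrier (tensor V W))"
    by (simp add: bij_betw_def)

  have add: "?f (v + w) = madd (tensor V W) (?f v) (?f w)"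
    if vw: "v \<in> mcarrier V" "w \<in> mcarrier V" for v w
  proof -
    have "madd (tensor V W) (?f v) (?f w) = (single (v, s) + single (w, s)) +o ?R"
    proof (rule set_eqI)
      fix z
      have "z \<in> madd (tensor V W) (?f v) (?f w) \<longleftrightarrow>
          (\<exists>a b. z = a + b \<and> a - single (v, s) \<in> ?R \<and> b - single (w, s) \<in> ?R)"
        by (auto simp: tensor_def coset_iff)
      also have "\<dots> \<longleftrightarrow> z - (single (v, s) + single (w, s)) \<in> ?R"
      proof
        assume "\<exists>a b. z = a + b \<and> a - single (v, s) \<in> ?R \<and> b - single (w, s) \<in> ?R"
        then obtain a b where ab: "z = a + b" "a - single (v, s) \<in> ?R" "b - single (w, s) \<in> ?R"
          by blast
        have "z - (single (v, s) + single (w, s)) = (a - single (v, s)) + (b - single (w, s))"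
          by (simp add: ab(1) algebra_simps)
        then show "z - (single (v, s) + single (w, s)) \<in> ?R"
          using R_add[OF ab(2,3)] by (simp only:)
      next
        assume "z - (single (v, s) + single (w, s)) \<in> ?R"
        then have "z = (z - single (w, s)) + single (w, s) \<and>
            (z - single (w, s)) - single (v, s) \<in> ?R \<and> single (w, s) - single (w, s) \<in> ?R"
          using R_0 by (simp add: algebra_simps)
        then show "\<exists>a b. z = a + b \<and> a - single (v, s) \<in> ?R \<and> b - single (w, s) \<in> ?R" by blast
      qed
      finally show "z \<in> madd (tensor V W) (?f v) (?f w) \<longleftrightarrow>
          z \<in> (single (v, s) + single (w, s)) +o ?R"
        by (simp add: coset_iff)
    qed
    moreover have "?f (v + w) = (single (v, s) + single (w, s)) +o ?R"
      using rel1[OF vw sW] by (intro coset_eqI[OF R]) (simp add: algebra_simps)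
    ultimately show ?thesis by simp
  qed

  (* Operations on the tensor product collect the results for all representatives of a coset; one
     representative suffices if h respects the relations. *)
  have image_coset: "{h a + n |a n. a \<in> u +o ?R \<and> n \<in> ?R} = h u +o ?R"
    if "\<And>n. n \<in> ?R \<Longrightarrow> h (u + n) - h u \<in> ?R" for h u
  proof (intro equalityI subsetI)
    fix z assume "z \<in> {h a + n |a n. a \<in> u +o ?R \<and> n \<in> ?R}"
    then obtain m n where "z = h (u + m) + n" "m \<in> ?R" "n \<in> ?R"
      by (auto simp: elt_set_plus_def)
    then show "z \<in> h u +o ?R" using R_add[OF that[of m], of n] by (simp add: coset_iff algebra_simps)
  next
    fix z assume "z \<in> h u +o ?R"
    then have "z = h u + (z - h u)" "u \<in> u +o ?R" "z - h u \<in> ?R"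
      using R_0 by (auto simp: coset_iff)
    then show "z \<in> {h a + n |a n. a \<in> u +o ?R \<and> n \<in> ?R}" by blast
  qed
  have scale: "?f (fscale c v) = mscale (tensor V W) c (?f v)" if v: "v \<in> mcarrier V" for c v
  proof -
    have "mscale (tensor V W) c (?f v) = fscale c (single (v, s)) +o ?R"
      by (simp add: tensor_def image_coset R_scale fun_space.scale_right_distrib)
    then show ?thesis using coset_eqI[OF R rel3[OF v sW]] by simp
  qed

  have act: "?f (fscale (of_int (hyp_sgn r \<sigma>)) (mact V v \<sigma>)) = mact (tensor V W) (?f v) \<sigma>"
    if v: "v \<in> mcarrier V" and \<sigma>: "\<sigma> \<in> hyperoct r" for v \<sigma>
  proof -
    let ?g = "\<lambda>(v, w). single (mact V v \<sigma>, mact W w \<sigma>) :: _ \<Rightarrow> 'f"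
    have free_act: "free_act V W u \<sigma> = lin_ext ?g u" for u
      by (simp add: free_act_def lin_ext_def case_prod_unfold)
    have fin: "finite_support n" and stable: "lin_ext ?g n \<in> ?R" if "n \<in> ?R" for n
    proof -
      note * = lin_ext_bilin_rels[OF R _ _ _ _ that, where g = ?g, unfolded V.madd V.mscale
          W.madd W.mscale prod.case V.act_add[OF \<sigma>] V.act_scale[OF \<sigma>] W.act_add[OF \<sigma>]
          W.act_scale[OF \<sigma>]]
      note ** = V.act_closed[OF \<sigma>] W.act_closed[OF \<sigma>]
      show "finite_support n" by (rule *(1)) (intro rel1 rel2 rel3 rel4 **; assumption)+
      show "lin_ext ?g n \<in> ?R" by (rule *(2)) (intro rel1 rel2 rel3 rel4 **; assumption)+
    qed
    have "mact (tensor V W) (?f v) \<sigma> = free_act V W (single (v, s)) \<sigma> +o ?R"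
      using stable fin by (simp add: tensor_def image_coset free_act lin_ext_add)
    also have "\<dots> = single (mact V v \<sigma>, fscale (of_int (hyp_sgn r \<sigma>)) s) +o ?R"
      by (simp add: free_act s_act[OF \<sigma>])
    also have "\<dots> = fscale (of_int (hyp_sgn r \<sigma>)) (single (mact V v \<sigma>, s)) +o ?R"
      by (rule coset_eqI[OF R rel4[OF V.act_closed[OF \<sigma> v] sW]])
    also have "\<dots> = ?f (fscale (of_int (hyp_sgn r \<sigma>)) (mact V v \<sigma>))"
      by (rule coset_eqI[OF R rel3[OF V.act_closed[OF \<sigma> v] sW], symmetric])
    finally show ?thesis by simp
  qed
  show ?thesis
    unfolding hmod_iso_def
    using bij add scale act
    by (intro exI[of _ ?f]) (simp add: sign_twist_def V.madd V.mscale)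
qed

section \<open>The sign character\<close>

lemma finite_hyperoct: "finite (hyperoct r)"
proof -
  have "finite (symbols r)"
    by (rule finite_subset[of _ "{- int r..int r}"]) (auto simp: symbols_def)
  then show ?thesis
    by (rule rev_finite_subset[OF finite_permutations]) (auto simp: hyperoct_def)
qed

lemma hyperoct_id: "id \<in> hyperoct r"
  by (simp add: hyperoct_def permutes_id)

lemma hyperoct_inv_inverse:
  assumes "\<sigma> \<in> hyperoct r"
  shows "inv \<sigma> \<circ> \<sigma> = id" "\<sigma> \<circ> inv \<sigma> = id" "inv (inv \<sigma>) = \<sigma>"
  using hyperoct_bij[OF assms] by (auto simp: bij_def inv_inv_eq surj_iff)

lemma hyperoct_abs_bij:
  assumes "\<sigma> \<in> hyperoct r"
  shows "bij_betw (\<lambda>i. \<bar>\<sigma> i\<bar>) {1..int r} {1..int r}"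
  using permutes_imp_bij[OF hyperoct_abs_permutes[OF assms]]
  by (rule bij_betw_cong[THEN iffD1, rotated]) (simp add: restrict_id_def)

lemma hyp_sgn_eq_prod:
  assumes "\<sigma> \<in> hyperoct r"
  shows "hyp_sgn r \<sigma> = (\<Prod>i\<in>{1..int r}. sgn (\<sigma> i)) * sign_on {1..int r} (\<lambda>i. \<bar>\<sigma> i\<bar>)"
proof -
  have "\<sigma> i \<noteq> 0" if "i \<in> {1..int r}" for i
  proof -
    have "\<bar>\<sigma> i\<bar> \<in> {1..int r}" using that hyperoct_abs_bij[OF assms] by (auto dest: bij_betwE)
    then show ?thesis by auto
  qed
  then have "(\<Prod>i\<in>{1..int r}. sgn (\<sigma> i)) = (\<Prod>i\<in>{1..int r}. if \<sigma> i < 0 then - 1 else 1)"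
    by (intro prod.cong) (auto simp: sgn_if)
  also have "\<dots> = (- 1) ^ card {i \<in> {1..int r}. \<sigma> i < 0}"
    by (simp flip: prod.inter_filter)
  finally show ?thesis by (simp add: hyp_sgn_def)
qed

text \<open>
  The parity of the number of sign changes of \<open>\<tau> \<circ> \<sigma>\<close> is computed by reindexing the product of the
  signs of \<open>\<tau>\<close> along the permutation of absolute values induced by \<open>\<sigma>\<close>.
\<close>

lemma hyp_sgn_comp:
  assumes s: "\<sigma> \<in> hyperoct r" and t: "\<tau> \<in> hyperoct r"
  shows "hyp_sgn r (\<tau> \<circ> \<sigma>) = hyp_sgn r \<tau> * hyp_sgn r \<sigma>"
proof -
  have e: "\<tau> (\<sigma> i) = sgn (\<sigma> i) * \<tau> \<bar>\<sigma> i\<bar>" for i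
    using t hyperoct_0[OF t] by (cases "\<sigma> i" "0 :: int" rule: linorder_cases) (auto simp: hyperoct_def)
  have "(\<Prod>i\<in>{1..int r}. sgn ((\<tau> \<circ> \<sigma>) i)) =
      (\<Prod>i\<in>{1..int r}. sgn (\<sigma> i)) * (\<Prod>i\<in>{1..int r}. sgn (\<tau> \<bar>\<sigma> i\<bar>))"
    unfolding prod.distrib[symmetric] by (intro prod.cong) (auto simp: e sgn_mult)
  also have "(\<Prod>i\<in>{1..int r}. sgn (\<tau> \<bar>\<sigma> i\<bar>)) = (\<Prod>i\<in>{1..int r}. sgn (\<tau> i))"
    by (rule prod.reindex_bij_betw[OF hyperoct_abs_bij[OF s]])
  finally have 1: "(\<Prod>i\<in>{1..int r}. sgn ((\<tau> \<circ> \<sigma>) i)) =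
      (\<Prod>i\<in>{1..int r}. sgn (\<sigma> i)) * (\<Prod>i\<in>{1..int r}. sgn (\<tau> i))" .
  have "(\<lambda>i. \<bar>(\<tau> \<circ> \<sigma>) i\<bar>) = (\<lambda>i. \<bar>\<tau> i\<bar>) \<circ> (\<lambda>i. \<bar>\<sigma> i\<bar>)"
    using hyperoct_abs[OF t] by (auto simp: fun_eq_iff) (metis abs_minus_cancel)
  then have 2: "sign_on {1..int r} (\<lambda>i. \<bar>(\<tau> \<circ> \<sigma>) i\<bar>) =
      sign_on {1..int r} (\<lambda>i. \<bar>\<tau> i\<bar>) * sign_on {1..int r} (\<lambda>i. \<bar>\<sigma> i\<bar>)"
    by (simp only:) (rule sign_on_compose; simp add: hyperoct_abs_bij s t)
  show ?thesis
    using hyp_sgn_eq_prod[OF hyperoct_comp[OF s t]] hyp_sgn_eq_prod[OF s] hyp_sgn_eq_prod[OF t]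
    unfolding 1 2 by simp
qed

lemma hyp_sgn_square [simp]: "hyp_sgn r \<sigma> * hyp_sgn r \<sigma> = 1"
proof -
  have "\<bar>hyp_sgn r \<sigma>\<bar> = 1"
    by (simp add: hyp_sgn_def sign_on_def sign_def abs_mult)
  then show ?thesis by (metis abs_mult_self_eq mult_1)
qed

lemma hyp_sgn_id [simp]: "hyp_sgn r id = 1"
proof -
  have "sign_on {1..int r} (\<lambda>i. \<bar>id i\<bar>) = sign_on {1..int r} (\<lambda>i. i)"
    by (rule sign_on_cong) auto
  moreover have "{i \<in> {1..int r}. id i < 0} = {}" by auto
  ultimately show ?thesis by (simp only: hyp_sgn_def) simp
qed

lemma hyp_sgn_inv:
  assumes "\<sigma> \<in> hyperoct r"
  shows "hyp_sgn r (inv \<sigma>) = hyp_sgn r \<sigma>"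
proof -
  have "hyp_sgn r (inv \<sigma>) * hyp_sgn r \<sigma> = 1"
    using hyp_sgn_comp[OF assms hyperoct_inv[OF assms]] by (simp add: hyperoct_inv_inverse[OF assms])
  then have "hyp_sgn r (inv \<sigma>) * (hyp_sgn r \<sigma> * hyp_sgn r \<sigma>) = hyp_sgn r \<sigma>"
    by (simp only: mult.assoc[symmetric] mult_1)
  then show ?thesis by simp
qed

section \<open>Bi-tableaux\<close>

lemma tableau_act_bitableaux_iff:
  assumes "\<sigma> \<in> hyperoct r"
  shows "tableau_act t \<sigma> \<in> bitableaux r lam \<longleftrightarrow> t \<in> bitableaux r lam"
proof
  assume "tableau_act t \<sigma> \<in> bitableaux r lam"
  from tableau_act_bitableaux[OF hyperoct_inv[OF assms] this]
  show "t \<in> bitableaux r lam"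
    by (simp add: tableau_act_comp hyperoct_inv_inverse[OF assms]) (simp add: tableau_act_def)
qed (rule tableau_act_bitableaux[OF assms])

lemma bitableau_zero_iff:
  assumes "t \<in> bitableaux r lam"
  shows "t b = 0 \<longleftrightarrow> b \<notin> bidiagram lam"
proof
  assume "t b = 0"
  show "b \<notin> bidiagram lam"
  proof
    assume "b \<in> bidiagram lam"
    then have "\<bar>t b\<bar> \<in> {1..int r}" using assms by (auto simp: bitableaux_def dest: bij_betwE)
    then show False using \<open>t b = 0\<close> by auto
  qed
qed (use assms in \<open>auto simp: bitableaux_def\<close>)

lemma bitableau_entry:
  assumes "t \<in> bitableaux r lam" "i \<in> symbols r"
  obtains b where "b \<in> bidiagram lam" "t b = i \<or> t b = - i"
proof -
  have "\<bar>i\<bar> \<in> (\<lambda>b. \<bar>t b\<bar>) ` bidiagram lam"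
    using assms by (auto simp: bitableaux_def bij_betw_def symbols_def)
  then obtain b where "b \<in> bidiagram lam" "\<bar>i\<bar> = \<bar>t b\<bar>" by blast
  then show thesis using that[of b] by (auto simp: abs_eq_iff)
qed

lemma tableau_act_free:
  assumes t: "t \<in> bitableaux r lam" and "\<sigma> \<in> hyperoct r" "\<tau> \<in> hyperoct r"
    and eq: "tableau_act t \<sigma> = tableau_act t \<tau>"
  shows "\<sigma> = \<tau>"
proof
  fix i
  have h: "\<sigma> (- j) = - \<sigma> j" "\<tau> (- j) = - \<tau> j" "j \<notin> symbols r \<Longrightarrow> \<sigma> j = j" "j \<notin> symbols r \<Longrightarrow> \<tau> j = j" for j
    using assms(2,3) by (auto simp: hyperoct_def permutes_def)
  show "\<sigma> i = \<tau> i"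
  proof (cases "i \<in> symbols r")
    case True
    then obtain b where "t b = i \<or> t b = - i" using bitableau_entry[OF t] by blast
    then show ?thesis using fun_cong[OF eq, of b] h(1,2)[of i] by (auto simp: tableau_act_def)
  qed (simp add: h)
qed

lemma tableau_act_transitive:
  assumes t: "t \<in> bitableaux r lam" and u: "u \<in> bitableaux r lam"
  obtains \<sigma> where "\<sigma> \<in> hyperoct r" "u = tableau_act t \<sigma>"
proof -
  let ?B = "bidiagram lam"
  (* The inverse function finds the box b whose entry in t is i or -i.  Thus F t u sends t b to u b
     and - t b to - u b, and F u t is its inverse. *)
  define F where "F t u i = (if i \<in> symbols r then
      sgn i * sgn (t (inv_into ?B (\<lambda>b. \<bar>t b\<bar>) \<bar>i\<bar>)) * u (inv_into ?B (\<lambda>b. \<bar>t b\<bar>) \<bar>i\<bar>) else i)"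
    for t u :: bitableau and i :: int
  have box: "inv_into ?B (\<lambda>b. \<bar>t b\<bar>) \<bar>t b\<bar> = b" "t b \<noteq> 0" "t b \<in> symbols r"
    if t: "t \<in> bitableaux r lam" and b: "b \<in> ?B" for t b
  proof -
    have "inj_on (\<lambda>b. \<bar>t b\<bar>) ?B" using t by (auto simp: bitableaux_def bij_betw_def)
    from inv_into_f_f[OF this b] show "inv_into ?B (\<lambda>b. \<bar>t b\<bar>) \<bar>t b\<bar> = b" .
    have "\<bar>t b\<bar> \<in> {1..int r}" using t b by (auto simp: bitableaux_def dest: bij_betwE)
    then show "t b \<noteq> 0" "t b \<in> symbols r" by (auto simp: symbols_def)
  qed
  have odd: "F t u (- i) = - F t u i" for t u i
    by (auto simp: F_def symbols_def sgn_minus)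
  have F: "F t u (t b) = u b"
    if "t \<in> bitableaux r lam" "b \<in> ?B" for t u b
    using box[OF that] by (simp add: F_def sgn_if)
  have cancel: "F u t (F t u i) = i \<and> F t u i \<in> symbols r"
    if t: "t \<in> bitableaux r lam" and u: "u \<in> bitableaux r lam" and i: "i \<in> symbols r" for t u i
  proof -
    obtain b where b: "b \<in> ?B" "t b = i \<or> t b = - i" using bitableau_entry[OF t i] .
    then have "i = t b \<or> i = - t b" by auto
    then have "F t u i = u b \<or> F t u i = - u b" "F u t (F t u i) = i"
      using F[OF t b(1), of u] F[OF u b(1), of t] odd[of t u "t b"] odd[of u t "u b"] by auto
    then show ?thesis using box(3)[OF u b(1)] by (auto simp: symbols_def)
  qed
  have "bij_betw (F t u) (symbols r) (symbols r)"
    using cancel[OF t u] cancel[OF u t] by (intro bij_betw_byWitness[where f' = "F u t"]) auto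
  then have "F t u permutes symbols r" by (rule bij_imp_permutes) (simp add: F_def)
  then have "F t u \<in> hyperoct r" using odd by (simp add: hyperoct_def)
  moreover have "u b = F t u (t b)" for b
  proof (cases "b \<in> ?B")
    case False
    then have "t b = 0" "u b = 0"
      using bitableau_zero_iff[OF t] bitableau_zero_iff[OF u] by auto
    then show ?thesis by (simp add: F_def symbols_def)
  qed (simp add: F t)
  ultimately show thesis by (intro that) (auto simp: tableau_act_def)
qed

lemma finite_bitableaux: "finite (bitableaux r lam)"
proof (cases "bitableaux r lam = {}")
  case False
  then obtain t where t: "t \<in> bitableaux r lam" by blast
  have "bitableaux r lam \<subseteq> tableau_act t ` hyperoct r"
    using tableau_act_transitive[OF t] by blast
  then show ?thesis using finite_surj[OF finite_hyperoct] by blast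
qed simp

text \<open>
  The group acts simply transitively on bi-tableaux, so its sign character becomes a sign of
  bi-tableaux once a base point is chosen.
\<close>

definition tableau_sign :: "nat \<Rightarrow> bipart \<Rightarrow> bitableau \<Rightarrow> int" where
  "tableau_sign r lam t = hyp_sgn r (SOME \<sigma>. \<sigma> \<in> hyperoct r \<and>
     t = tableau_act (SOME u. u \<in> bitableaux r lam) \<sigma>)"

lemma tableau_sign_square [simp]: "tableau_sign r lam t * tableau_sign r lam t = 1"
  by (simp add: tableau_sign_def)

lemma tableau_sign_act:
  assumes t: "t \<in> bitableaux r lam" and s: "\<sigma> \<in> hyperoct r"
  shows "tableau_sign r lam (tableau_act t \<sigma>) = hyp_sgn r \<sigma> * tableau_sign r lam t"
proof -
  define u where "u = (SOME u. u \<in> bitableaux r lam)"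
  have u: "u \<in> bitableaux r lam" unfolding u_def using someI[where P = "\<lambda>u. u \<in> bitableaux r lam", OF t] .
  have sign: "tableau_sign r lam (tableau_act u \<tau>) = hyp_sgn r \<tau>" if "\<tau> \<in> hyperoct r" for \<tau>
  proof -
    have "(SOME \<rho>. \<rho> \<in> hyperoct r \<and> tableau_act u \<tau> = tableau_act u \<rho>) = \<tau>"
      using that tableau_act_free[OF u] by (intro some_equality) auto
    then show ?thesis by (simp add: tableau_sign_def u_def)
  qed
  obtain \<tau> where "\<tau> \<in> hyperoct r" "t = tableau_act u \<tau>" using tableau_act_transitive[OF u t] .
  then show ?thesis
    using sign s by (simp add: tableau_act_comp hyperoct_comp hyp_sgn_comp)
qed

subsection \<open>Transposition\<close>

text \<open>Conjugation of bi-partitions also exchanges the two components.\<close>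

fun flip_box :: "box + box \<Rightarrow> box + box" where
  "flip_box (Inl (i, j)) = Inr (j, i)"
| "flip_box (Inr (i, j)) = Inl (j, i)"

definition transpose_tableau :: "bitableau \<Rightarrow> bitableau" where
  "transpose_tableau t = t \<circ> flip_box"

lemma flip_box_flip_box [simp]: "flip_box (flip_box b) = b"
  by (cases b rule: flip_box.cases) auto

lemma transpose_transpose_tableau [simp]: "transpose_tableau (transpose_tableau t) = t"
  by (simp add: transpose_tableau_def fun_eq_iff)

lemma transpose_tableau_act: "transpose_tableau (tableau_act t \<sigma>) = tableau_act (transpose_tableau t) \<sigma>"
  by (simp add: transpose_tableau_def tableau_act_def comp_assoc)

lemma transpose_tableau_eq_iff [simp]: "transpose_tableau t = transpose_tableau u \<longleftrightarrow> t = u"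
  by (metis transpose_transpose_tableau)

text \<open>In a weakly decreasing list the entries above a given bound form an initial segment.\<close>

lemma length_filter_partition:
  fixes i :: nat
  assumes "sorted_wrt (\<ge>) \<mu>"
  shows "j < length (filter (\<lambda>k. i < k) \<mu>) \<longleftrightarrow> j < length \<mu> \<and> i < \<mu> ! j"
  using assms
proof (induction \<mu> arbitrary: j)
  case (Cons m \<mu>)
  show ?case
  proof (cases "i < m")
    case True
    then show ?thesis using Cons by (cases j) auto
  next
    case False
    then have "\<forall>k\<in>set \<mu>. \<not> i < k" using Cons.prems by auto
    then have "filter (\<lambda>k. i < k) (m # \<mu>) = []" using False by auto
    moreover have "\<not> i < (m # \<mu>) ! j" if "j < length (m # \<mu>)"
      using nth_mem[OF that] \<open>\<forall>k\<in>set \<mu>. \<not> i < k\<close> False by auto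
    ultimately show ?thesis by auto
  qed
qed simp

lemma diagram_conjugate:
  assumes "is_partition \<mu>"
  shows "(i, j) \<in> diagram (conjugate \<mu>) \<longleftrightarrow> (j, i) \<in> diagram \<mu>"
proof -
  have s: "sorted_wrt (\<ge>) \<mu>" using assms by (simp add: is_partition_def)
  have "i < hd \<mu>" if "j < length \<mu>" "i < \<mu> ! j"
  proof (cases \<mu>)
    case (Cons m \<nu>)
    have "\<mu> ! j \<le> m"
      using nth_mem[OF that(1)] s Cons by auto
    then show ?thesis using that(2) Cons by simp
  qed (use that in simp)
  then show ?thesis
    using length_filter_partition[OF s, of j i] by (auto simp: diagram_def conjugate_def)
qed

context
  fixes r :: nat and lam :: bipart
  assumes lam: "is_bipartition r lam"
begin

lemma diagram_biconjugate:
  "(i, j) \<in> diagram (fst (biconjugate lam)) \<longleftrightarrow> (j, i) \<in> diagram (snd lam)"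
  "(i, j) \<in> diagram (snd (biconjugate lam)) \<longleftrightarrow> (j, i) \<in> diagram (fst lam)"
  using lam by (auto simp: biconjugate_def is_bipartition_def diagram_conjugate)

lemma flip_box_bidiagram: "flip_box b \<in> bidiagram lam \<longleftrightarrow> b \<in> bidiagram (biconjugate lam)"
  by (cases b rule: flip_box.cases) (auto simp: bidiagram_def diagram_biconjugate)

lemma transpose_tableau_bitableaux:
  "transpose_tableau t \<in> bitableaux r (biconjugate lam) \<longleftrightarrow> t \<in> bitableaux r lam"
proof -
  have flip: "bij_betw flip_box (bidiagram (biconjugate lam)) (bidiagram lam)"
  proof (rule bij_betw_byWitness[where f' = flip_box])
    show "flip_box ` bidiagram lam \<subseteq> bidiagram (biconjugate lam)"
      by (auto simp flip: flip_box_bidiagram)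
  qed (auto simp: flip_box_bidiagram)
  have "bij_betw (\<lambda>b. \<bar>t b\<bar>) (bidiagram lam) {1..int r} \<longleftrightarrow>
      bij_betw (\<lambda>b. \<bar>transpose_tableau t b\<bar>) (bidiagram (biconjugate lam)) {1..int r}"
    using bij_betw_comp_iff[OF flip, of "\<lambda>b. \<bar>t b\<bar>"] by (simp add: transpose_tableau_def comp_def)
  moreover have "(\<forall>b. b \<notin> bidiagram lam \<longrightarrow> t b = 0) \<longleftrightarrow>
      (\<forall>b. b \<notin> bidiagram (biconjugate lam) \<longrightarrow> transpose_tableau t b = 0)"
    unfolding flip_box_bidiagram[symmetric] transpose_tableau_def comp_def
    by (metis flip_box_flip_box)
  ultimately show ?thesis by (simp add: bitableaux_def)
qed

lemma transpose_tableau_image: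
  "transpose_tableau ` bitableaux r lam = bitableaux r (biconjugate lam)"
proof (intro equalityI subsetI)
  fix t assume "t \<in> bitableaux r (biconjugate lam)"
  then have "transpose_tableau t \<in> bitableaux r lam"
    using transpose_tableau_bitableaux[of "transpose_tableau t"] by simp
  then show "t \<in> transpose_tableau ` bitableaux r lam"
    by (rule rev_image_eqI) simp
qed (auto simp: transpose_tableau_bitableaux)

lemma row_group_transpose:
  "row_group r (biconjugate lam) (transpose_tableau t) = col_group r lam t"
  "col_group r (biconjugate lam) (transpose_tableau t) = row_group r lam t"
proof -
  have "row1 (biconjugate lam) (transpose_tableau t) i = col2 lam t i"
    "row2 (biconjugate lam) (transpose_tableau t) i = col1 lam t i"
    "col1 (biconjugate lam) (transpose_tableau t) i = row2 lam t i"
    "col2 (biconjugate lam) (transpose_tableau t) i = row1 lam t i" for i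
    by (simp_all add: row1_def row2_def col1_def col2_def transpose_tableau_def diagram_biconjugate)
  then show "row_group r (biconjugate lam) (transpose_tableau t) = col_group r lam t"
    "col_group r (biconjugate lam) (transpose_tableau t) = row_group r lam t"
    by (auto simp: row_group_def col_group_def)
qed

end

lemma col_group_tableau_act:
  assumes s: "\<sigma> \<in> hyperoct r"
  shows "bij_betw (\<lambda>\<gamma>. \<sigma> \<circ> \<gamma> \<circ> inv \<sigma>) (col_group r lam t) (col_group r lam (tableau_act t \<sigma>))"
proof -
  note i = hyperoct_inv_inverse[OF s]
  have conj: "\<tau> \<circ> \<gamma> \<circ> inv \<tau> \<in> col_group r lam (tableau_act u \<tau>)"
    if t: "\<tau> \<in> hyperoct r" and g: "\<gamma> \<in> col_group r lam u" for \<tau> \<gamma> u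
  proof -
    have odd: "\<And>i. \<tau> (- i) = - \<tau> i" using t by (simp add: hyperoct_def)
    have cols: "col1 lam (tableau_act u \<tau>) j = \<tau> ` col1 lam u j"
      "col2 lam (tableau_act u \<tau>) j = \<tau> ` col2 lam u j" for j
      by (auto simp: col1_def col2_def tableau_act_def)
    have pm: "plus_minus (\<tau> ` A) = \<tau> ` plus_minus A" for A
      by (auto simp: plus_minus_def image_Un image_image odd)
    have im: "(\<tau> \<circ> \<gamma> \<circ> inv \<tau>) ` \<tau> ` A = \<tau> ` \<gamma> ` A" for A
      using bij_is_inj[OF hyperoct_bij[OF t]] by (simp add: image_image)
    have "\<tau> \<circ> \<gamma> \<circ> inv \<tau> \<in> hyperoct r"
      using t g by (auto simp: col_group_def intro!: hyperoct_comp hyperoct_inv)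
    then show ?thesis
      using g unfolding col_group_def mem_Collect_eq cols pm im by simp
  qed
  have conj_inv: "inv \<sigma> \<circ> \<gamma> \<circ> \<sigma> \<in> col_group r lam t" if "\<gamma> \<in> col_group r lam (tableau_act t \<sigma>)" for \<gamma>
    using conj[OF hyperoct_inv[OF s] that] unfolding tableau_act_comp i by (simp add: tableau_act_def)
  have "inv \<sigma> (\<sigma> x) = x" "\<sigma> (inv \<sigma> x) = x" for x
    using i by (metis comp_apply id_apply)+
  then have "inv \<sigma> \<circ> (\<sigma> \<circ> \<gamma> \<circ> inv \<sigma>) \<circ> \<sigma> = \<gamma>" "\<sigma> \<circ> (inv \<sigma> \<circ> \<gamma> \<circ> \<sigma>) \<circ> inv \<sigma> = \<gamma>" for \<gamma>
    by (simp_all add: fun_eq_iff)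
  then show ?thesis
    using conj[OF s, of _ t] conj_inv
    by (intro bij_betw_byWitness[where f' = "\<lambda>\<gamma>. inv \<sigma> \<circ> \<gamma> \<circ> \<sigma>"]) blast+
qed

section \<open>Polytabloids\<close>

lemma tabloids_eq: "tabloids r lam = tabloid r lam ` bitableaux r lam"
  by (auto simp: tabloids_def tabloid_def quotient_def)

lemma tabloid_eq_iff:
  assumes "t \<in> bitableaux r lam" "u \<in> bitableaux r lam"
  shows "tabloid r lam t = tabloid r lam u \<longleftrightarrow> (\<exists>\<rho>\<in>row_group r lam u. t = tableau_act u \<rho>)"
proof -
  have "tabloid r lam t = tabloid r lam u \<longleftrightarrow> (u, t) \<in> row_equiv r lam"
    unfolding tabloid_def using eq_equiv_class_iff[OF equiv_row_equiv] assms by metis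
  then show ?thesis using assms by (simp add: row_equiv_def)
qed

lemma group_subset_hyperoct:
  "row_group r lam t \<subseteq> hyperoct r" "col_group r lam t \<subseteq> hyperoct r"
  by (auto simp: row_group_def col_group_def)

lemma polytabloid_eq_sum:
  "polytabloid r lam t = (\<Sum>\<gamma>\<in>col_group r lam t.
     fscale (of_int (hyp_sgn r \<gamma>)) (single (tabloid r lam (tableau_act t \<gamma>)) :: _ \<Rightarrow> 'f::field))"
proof -
  have "polytabloid r lam t = (\<Sum>\<gamma>\<in>hyperoct r. if \<gamma> \<in> col_group r lam t then
     fscale (of_int (hyp_sgn r \<gamma>)) (single (tabloid r lam (tableau_act t \<gamma>)) :: _ \<Rightarrow> 'f) else 0)"
    unfolding polytabloid_def perm_alg_act_def col_antisym_def
    by (intro sum.cong) (simp_all add: perm_act_single tabloid_act_tabloid)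
  also have "\<dots> = (\<Sum>\<gamma>\<in>hyperoct r \<inter> col_group r lam t.
     fscale (of_int (hyp_sgn r \<gamma>)) (single (tabloid r lam (tableau_act t \<gamma>))))"
    by (simp add: sum.inter_restrict finite_hyperoct)
  also have "hyperoct r \<inter> col_group r lam t = col_group r lam t"
    using group_subset_hyperoct by blast
  finally show ?thesis .
qed

lemma polytabloid_outside:
  assumes "t \<in> bitableaux r lam" "X \<notin> tabloids r lam"
  shows "polytabloid r lam t X = (0 :: 'f::field)"
proof -
  have "single (tabloid r lam (tableau_act t \<gamma>)) X = (0 :: 'f)" if "\<gamma> \<in> col_group r lam t" for \<gamma>
    using that assms group_subset_hyperoct(2)[of r lam t]
    by (auto simp: single_def tabloids_eq tableau_act_bitableaux_iff)
  then show ?thesis by (simp add: polytabloid_eq_sum sum_fun_apply fscale_apply)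
qed

lemma polytabloid_at_tabloid:
  assumes t: "t \<in> bitableaux r lam" and u: "u \<in> bitableaux r lam"
  shows "polytabloid r lam t (tabloid r lam u) = (\<Sum>\<gamma> | \<gamma> \<in> col_group r lam t \<and>
     (\<exists>\<rho>\<in>row_group r lam u. tableau_act t \<gamma> = tableau_act u \<rho>). of_int (hyp_sgn r \<gamma>) :: 'f::field)"
proof -
  have fin: "finite (col_group r lam t)"
    using finite_subset[OF group_subset_hyperoct(2) finite_hyperoct] .
  have "polytabloid r lam t (tabloid r lam u) = (\<Sum>\<gamma>\<in>col_group r lam t.
      if tabloid r lam (tableau_act t \<gamma>) = tabloid r lam u then of_int (hyp_sgn r \<gamma>) else (0 :: 'f))"
    unfolding polytabloid_eq_sum sum_fun_apply
    by (intro sum.cong) (auto simp: single_def fscale_apply)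
  also have "\<dots> = (\<Sum>\<gamma> | \<gamma> \<in> col_group r lam t \<and>
      tabloid r lam (tableau_act t \<gamma>) = tabloid r lam u. of_int (hyp_sgn r \<gamma>))"
    by (rule sum.inter_filter[OF fin, symmetric])
  also have "{\<gamma> \<in> col_group r lam t. tabloid r lam (tableau_act t \<gamma>) = tabloid r lam u} =
      {\<gamma> \<in> col_group r lam t. \<exists>\<rho>\<in>row_group r lam u. tableau_act t \<gamma> = tableau_act u \<rho>}"
  proof (rule Collect_cong, rule conj_cong[OF refl])
    fix \<gamma> assume "\<gamma> \<in> col_group r lam t"
    then have "tableau_act t \<gamma> \<in> bitableaux r lam"
      using t group_subset_hyperoct(2) tableau_act_bitableaux by blast
    then show "tabloid r lam (tableau_act t \<gamma>) = tabloid r lam u \<longleftrightarrow>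
        (\<exists>\<rho>\<in>row_group r lam u. tableau_act t \<gamma> = tableau_act u \<rho>)"
      by (rule tabloid_eq_iff[OF _ u])
  qed
  finally show ?thesis .
qed

text \<open>
  Both sides are signed counts of the pairs \<open>\<gamma> \<in> C\<^sub>t\<close>, \<open>\<rho> \<in> R\<^sub>u\<close> with \<open>t\<gamma> = u\<rho>\<close>, because
  transposition exchanges row and column groups; the left side weighs a pair by the sign of \<open>\<gamma>\<close>
  and the right side by that of \<open>\<rho>\<close>.  When \<open>u = t\<sigma>\<close>, such a pair satisfies \<open>\<gamma> = \<sigma>\<rho>\<close>,
  that is \<open>\<rho> \<circ> \<sigma>\<close> as a function.
\<close>

lemma polytabloid_transpose:
  assumes lam: "is_bipartition r lam"
    and t: "t \<in> bitableaux r lam" and s: "\<sigma> \<in> hyperoct r"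
  defines "u \<equiv> tableau_act t \<sigma>"
  shows "polytabloid r lam t (tabloid r lam u) = of_int (hyp_sgn r \<sigma>) *
    (polytabloid r (biconjugate lam) (transpose_tableau u)
      (tabloid r (biconjugate lam) (transpose_tableau t)) :: 'f::field)"
proof -
  have u: "u \<in> bitableaux r lam" using t s by (simp add: u_def tableau_act_bitableaux_iff)
  have eq_iff: "tableau_act t \<gamma> = tableau_act u \<rho> \<longleftrightarrow> \<gamma> = \<rho> \<circ> \<sigma>"
    if "\<gamma> \<in> hyperoct r" "\<rho> \<in> hyperoct r" for \<gamma> \<rho>
    using tableau_act_free[OF t that(1) hyperoct_comp[OF s that(2)]]
    by (auto simp: u_def tableau_act_comp)
  have R: "\<rho> \<in> hyperoct r" if "\<rho> \<in> row_group r lam u" for \<rho>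
    using that group_subset_hyperoct(1) by blast
  have C: "\<gamma> \<in> hyperoct r" if "\<gamma> \<in> col_group r lam t" for \<gamma>
    using that group_subset_hyperoct(2) by blast
  let ?A = "{\<gamma>. \<gamma> \<in> col_group r lam t \<and> (\<exists>\<rho>\<in>row_group r lam u. tableau_act t \<gamma> = tableau_act u \<rho>)}"
  let ?B = "{\<rho>. \<rho> \<in> row_group r lam u \<and> (\<exists>\<gamma>\<in>col_group r lam t. tableau_act u \<rho> = tableau_act t \<gamma>)}"
  have "inj_on (\<lambda>\<rho>. \<rho> \<circ> \<sigma>) ?B"
    using bij_is_surj[OF hyperoct_bij[OF s]] by (auto simp: inj_on_def fun_eq_iff surj_def) metis
  moreover have "(\<lambda>\<rho>. \<rho> \<circ> \<sigma>) ` ?B = ?A"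
  proof (intro equalityI subsetI)
    fix \<gamma> assume "\<gamma> \<in> (\<lambda>\<rho>. \<rho> \<circ> \<sigma>) ` ?B"
    then obtain \<rho> \<gamma>' where *: "\<gamma> = \<rho> \<circ> \<sigma>" "\<rho> \<in> row_group r lam u" "\<gamma>' \<in> col_group r lam t"
      "tableau_act u \<rho> = tableau_act t \<gamma>'" by blast
    then have "\<gamma>' = \<gamma>" using eq_iff[OF C[OF *(3)] R[OF *(2)]] by simp
    then show "\<gamma> \<in> ?A" using *(2,3) *(4)[symmetric] by blast
  next
    fix \<gamma> assume "\<gamma> \<in> ?A"
    then obtain \<rho> where *: "\<gamma> \<in> col_group r lam t" "\<rho> \<in> row_group r lam u"
      "tableau_act t \<gamma> = tableau_act u \<rho>" by blast
    then have "\<gamma> = \<rho> \<circ> \<sigma>" using eq_iff[OF C[OF *(1)] R[OF *(2)]] by simp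
    moreover have "\<rho> \<in> ?B" using *(1,2) *(3)[symmetric] by blast
    ultimately show "\<gamma> \<in> (\<lambda>\<rho>. \<rho> \<circ> \<sigma>) ` ?B" by blast
  qed
  ultimately have "bij_betw (\<lambda>\<rho>. \<rho> \<circ> \<sigma>) ?B ?A" by (simp add: bij_betw_def)
  then have "(\<Sum>\<gamma>\<in>?A. of_int (hyp_sgn r \<gamma>) :: 'f) = (\<Sum>\<rho>\<in>?B. of_int (hyp_sgn r (\<rho> \<circ> \<sigma>)))"
    by (rule sum.reindex_bij_betw[symmetric])
  also have "\<dots> = of_int (hyp_sgn r \<sigma>) * (\<Sum>\<rho>\<in>?B. of_int (hyp_sgn r \<rho>))"
    unfolding sum_distrib_left by (intro sum.cong) (simp_all add: hyp_sgn_comp[OF s R])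
  also have "(\<Sum>\<rho>\<in>?B. of_int (hyp_sgn r \<rho>) :: 'f) =
      polytabloid r (biconjugate lam) (transpose_tableau u)
        (tabloid r (biconjugate lam) (transpose_tableau t))"
    using t u by (simp add: polytabloid_at_tabloid transpose_tableau_bitableaux[OF lam]
        row_group_transpose[OF lam] flip: transpose_tableau_act)
  finally show ?thesis by (simp add: polytabloid_at_tabloid[OF t u])
qed

lemma perm_act_linear:
  "perm_act (v + w) \<sigma> = perm_act v \<sigma> + perm_act w \<sigma>"
  "perm_act (fscale c v) \<sigma> = fscale c (perm_act v \<sigma>)" "perm_act 0 \<sigma> = (0 :: _ \<Rightarrow> 'f::field)"
  by (auto simp: perm_act_def fscale_def fun_eq_iff)

lemma perm_act_sum: "perm_act (\<Sum>i\<in>I. f i) \<sigma> = (\<Sum>i\<in>I. perm_act (f i) \<sigma> :: _ \<Rightarrow> 'f::field)"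
  by (simp add: perm_act_def sum_fun_apply fun_eq_iff)

lemma polytabloid_act:
  assumes s: "\<sigma> \<in> hyperoct r"
  shows "perm_act (polytabloid r lam t) \<sigma> = (polytabloid r lam (tableau_act t \<sigma>) :: _ \<Rightarrow> 'f::field)"
proof -
  let ?summand = "\<lambda>t \<gamma>. fscale (of_int (hyp_sgn r \<gamma>)) (single (tabloid r lam (tableau_act t \<gamma>)) :: _ \<Rightarrow> 'f)"
  have "perm_act (?summand t \<gamma>) \<sigma> = ?summand (tableau_act t \<sigma>) (\<sigma> \<circ> \<gamma> \<circ> inv \<sigma>)"
    if "\<gamma> \<in> col_group r lam t" for \<gamma>
  proof -
    have g: "\<gamma> \<in> hyperoct r" using that group_subset_hyperoct by blast
    have "hyp_sgn r (\<sigma> \<circ> \<gamma> \<circ> inv \<sigma>) = hyp_sgn r \<sigma> * hyp_sgn r \<gamma> * hyp_sgn r \<sigma>"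
      using s g by (simp add: hyp_sgn_comp hyperoct_comp hyperoct_inv hyp_sgn_inv del: comp_apply)
    also have "\<dots> = (hyp_sgn r \<sigma> * hyp_sgn r \<sigma>) * hyp_sgn r \<gamma>" by (simp only: ac_simps)
    finally have "hyp_sgn r (\<sigma> \<circ> \<gamma> \<circ> inv \<sigma>) = hyp_sgn r \<gamma>" by simp
    moreover have "\<sigma> \<circ> \<gamma> \<circ> inv \<sigma> \<circ> \<sigma> = \<sigma> \<circ> \<gamma>"
      by (metis comp_assoc comp_id hyperoct_inv_inverse(1)[OF s])
    ultimately show ?thesis
      by (simp add: perm_act_linear perm_act_single[OF s] tabloid_act_tabloid[OF s] tableau_act_comp)
  qed
  then have "perm_act (polytabloid r lam t) \<sigma> =
      (\<Sum>\<gamma>\<in>col_group r lam t. ?summand (tableau_act t \<sigma>) (\<sigma> \<circ> \<gamma> \<circ> inv \<sigma>))"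
    by (simp add: polytabloid_eq_sum perm_act_sum)
  also have "\<dots> = (\<Sum>\<gamma>\<in>col_group r lam (tableau_act t \<sigma>). ?summand (tableau_act t \<sigma>) \<gamma>)"
    by (rule sum.reindex_bij_betw[OF col_group_tableau_act[OF s]])
  finally show ?thesis by (simp add: polytabloid_eq_sum)
qed

lemma specht_simps:
  "mcarrier (specht r lam) = fun_space.span (polytabloid r lam ` bitableaux r lam)"
  "madd (specht r lam) = (+)" "mscale (specht r lam) = fscale" "mact (specht r lam) = perm_act"
  by (simp_all add: specht_def perm_module_def)

lemma fun_module_specht: "fun_module r (specht r lam :: ('f::field, bitabloid \<Rightarrow> 'f) hmod)"
proof
  fix \<sigma> and v :: "bitabloid \<Rightarrow> 'f" assume s: "\<sigma> \<in> hyperoct r" and "v \<in> mcarrier (specht r lam)"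
  then have "v \<in> fun_space.span (polytabloid r lam ` bitableaux r lam)" by (simp add: specht_simps)
  then have "perm_act v \<sigma> \<in> fun_space.span (polytabloid r lam ` bitableaux r lam)"
  proof (induction rule: span_fun_induct)
    case base
    have "perm_act 0 \<sigma> \<in> fun_space.span (polytabloid r lam ` bitableaux r lam :: (_ \<Rightarrow> 'f) set)"
      by (simp only: perm_act_linear fun_space.span_zero)
    then show ?case .
  next
    case (step c b w)
    then have "perm_act b \<sigma> \<in> polytabloid r lam ` bitableaux r lam"
      using s by (auto simp: polytabloid_act tableau_act_bitableaux_iff)
    then have "perm_act (fscale c b + w) \<sigma> \<in> fun_space.span (polytabloid r lam ` bitableaux r lam)"
      using step(3) unfolding perm_act_linear
      by (rule fun_space.span_add[OF fun_space.span_scale[OF fun_space.span_base]])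
    then show ?case .
  qed
  then show "mact (specht r lam) v \<sigma> \<in> mcarrier (specht r lam)" by (simp add: specht_simps)
qed (simp_all add: specht_simps perm_act_linear)

lemma specht_outside:
  assumes "v \<in> mcarrier (specht r lam)" "X \<notin> tabloids r lam"
  shows "v X = (0 :: 'f::field)"
  using assms(1) unfolding specht_simps
  by (rule span_vanishing) (use assms(2) polytabloid_outside in blast)

section \<open>The sign module\<close>

text \<open>
  For a single column in the first component, the row groups are trivial and the column groups are
  the whole group.  Hence bi-tabloids are permuted simply transitively, \<open>e\<^sub>t\<close> is the signed sum of
  all of them, and replacing \<open>t\<close> by \<open>t\<sigma>\<close> multiplies it by the sign of \<open>\<sigma>\<close>.
\<close>

context
  fixes r :: nat and column :: bipart
  defines "column \<equiv> (replicate r 1, [])"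
begin

lemma bidiagram_column: "bidiagram column = {Inl (i, 0) |i. i < r}"
  by (auto simp: bidiagram_def diagram_def column_def)

lemma bitableaux_column_nonempty: "bitableaux r column \<noteq> {}"
proof -
  let ?t = "\<lambda>b. if b \<in> bidiagram column then int (fst (projl b)) + 1 else 0"
  have "bij_betw (\<lambda>b. \<bar>?t b\<bar>) (bidiagram column) {1..int r}"
    by (rule bij_betw_byWitness[where f' = "\<lambda>k. Inl (nat (k - 1), 0)"])
      (auto simp: bidiagram_column)
  then have "?t \<in> bitableaux r column" by (simp add: bitableaux_def)
  then show ?thesis by blast
qed

lemma row_group_column:
  assumes t: "t \<in> bitableaux r column" and "\<rho> \<in> row_group r column t"
  shows "\<rho> = id"
proof (rule tableau_act_free[OF t _ hyperoct_id])
  show h: "\<rho> \<in> hyperoct r" using assms(2) by (simp add: row_group_def)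
  show "tableau_act t \<rho> = tableau_act t id"
  proof
    fix b
    show "tableau_act t \<rho> b = tableau_act t id b"
    proof (cases "b \<in> bidiagram column")
      case True
      then obtain i where i: "b = Inl (i, 0)" "i < r" by (auto simp: bidiagram_column)
      have "row1 column t i = {t b}" using i by (auto simp: row1_def diagram_def column_def)
      moreover have "\<rho> ` row1 column t i = row1 column t i" using assms(2) by (simp add: row_group_def)
      ultimately show ?thesis by (simp add: tableau_act_def)
    next
      case False
      then have "t b = 0" using bitableau_zero_iff[OF t] by simp
      then show ?thesis using hyperoct_0[OF h] by (simp add: tableau_act_def)
    qed
  qed
qed

lemma col_group_column:
  assumes t: "t \<in> bitableaux r column"
  shows "col_group r column t = hyperoct r"
proof -
  have "plus_minus (col1 column t 0) = symbols r"
  proof (intro equalityI subsetI)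
    fix i assume i: "i \<in> symbols r"
    obtain b where "b \<in> bidiagram column" "t b = i \<or> t b = - i" using bitableau_entry[OF t i] .
    moreover from this obtain k where "b = Inl (k, 0)" "k < r" by (auto simp: bidiagram_column)
    ultimately have "i \<in> col1 column t 0 \<or> - i \<in> col1 column t 0"
      by (auto simp: col1_def diagram_def column_def)
    then show "i \<in> plus_minus (col1 column t 0)" by (force simp: plus_minus_def)
  next
    fix i assume "i \<in> plus_minus (col1 column t 0)"
    then obtain b where b: "b \<in> bidiagram column" "i = t b \<or> i = - t b"
      by (auto simp: plus_minus_def col1_def bidiagram_def)
    then have "\<bar>t b\<bar> \<in> {1..int r}" using t by (auto simp: bitableaux_def dest: bij_betwE)
    then show "i \<in> symbols r" using b(2) by (auto simp: symbols_def)
  qed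
  moreover have "col1 column t j = {}" if "j \<noteq> 0" for j
    using that by (auto simp: col1_def diagram_def column_def)
  moreover have "col2 column t j = {}" for j
    by (simp add: col2_def diagram_def column_def)
  moreover have "\<sigma> ` symbols r = symbols r" if "\<sigma> \<in> hyperoct r" for \<sigma>
    using that by (auto simp: hyperoct_def permutes_image)
  ultimately have "\<sigma> ` plus_minus (col1 column t j) = plus_minus (col1 column t j)" "\<sigma> ` col2 column t j = col2 column t j"
    if "\<sigma> \<in> hyperoct r" for \<sigma> j
    using that by (cases "j = 0"; simp add: plus_minus_def)+
  then show ?thesis unfolding col_group_def by blast
qed

lemma polytabloid_column_act:
  assumes t: "t \<in> bitableaux r column" and s: "\<sigma> \<in> hyperoct r"
  shows "polytabloid r column (tableau_act t \<sigma>) =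
    fscale (of_int (hyp_sgn r \<sigma>)) (polytabloid r column t :: _ \<Rightarrow> 'f::field)"
proof -
  let ?v = "\<lambda>\<gamma>. single (tabloid r column (tableau_act t \<gamma>)) :: _ \<Rightarrow> 'f"
  have "\<gamma> \<circ> \<sigma> \<circ> inv \<sigma> = \<gamma>" "\<gamma> \<circ> inv \<sigma> \<circ> \<sigma> = \<gamma>" for \<gamma>
    unfolding comp_assoc hyperoct_inv_inverse[OF s] by simp_all
  then have bij: "bij_betw (\<lambda>\<gamma>. \<gamma> \<circ> \<sigma>) (hyperoct r) (hyperoct r)"
    using hyperoct_comp[OF s] hyperoct_comp[OF hyperoct_inv[OF s]]
    by (intro bij_betw_byWitness[where f' = "\<lambda>\<gamma>. \<gamma> \<circ> inv \<sigma>"]) blast+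
  have sgn: "hyp_sgn r \<gamma> = hyp_sgn r \<sigma> * hyp_sgn r (\<gamma> \<circ> \<sigma>)" if "\<gamma> \<in> hyperoct r" for \<gamma>
  proof -
    have "hyp_sgn r \<sigma> * hyp_sgn r (\<gamma> \<circ> \<sigma>) = (hyp_sgn r \<sigma> * hyp_sgn r \<sigma>) * hyp_sgn r \<gamma>"
      unfolding hyp_sgn_comp[OF s that] by (simp only: ac_simps)
    then show ?thesis by simp
  qed
  have "polytabloid r column (tableau_act t \<sigma>) =
      (\<Sum>\<gamma>\<in>hyperoct r. fscale (of_int (hyp_sgn r \<gamma>)) (?v (\<gamma> \<circ> \<sigma>)))"
    using t s by (simp add: polytabloid_eq_sum col_group_column tableau_act_bitableaux_iff
        tableau_act_comp)
  also have "\<dots> = (\<Sum>\<gamma>\<in>hyperoct r. fscale (of_int (hyp_sgn r \<sigma> * hyp_sgn r (\<gamma> \<circ> \<sigma>))) (?v (\<gamma> \<circ> \<sigma>)))"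
    by (intro sum.cong refl) (simp only: sgn)
  also have "\<dots> = (\<Sum>\<gamma>\<in>hyperoct r. fscale (of_int (hyp_sgn r \<sigma> * hyp_sgn r \<gamma>)) (?v \<gamma>))"
    by (rule sum.reindex_bij_betw[OF bij])
  also have "\<dots> = fscale (of_int (hyp_sgn r \<sigma>)) (polytabloid r column t)"
    by (simp add: polytabloid_eq_sum col_group_column[OF t] fun_space.scale_sum_right)
  finally show ?thesis .
qed

lemma polytabloid_column_nonzero:
  assumes t: "t \<in> bitableaux r column"
  shows "polytabloid r column t \<noteq> (0 :: _ \<Rightarrow> 'f::field)"
proof -
  have "{\<gamma> \<in> col_group r column t. \<exists>\<rho>\<in>row_group r column t. tableau_act t \<gamma> = tableau_act t \<rho>} = {id}"
  proof (intro equalityI subsetI)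
    fix \<gamma> assume "\<gamma> \<in> {\<gamma> \<in> col_group r column t. \<exists>\<rho>\<in>row_group r column t. tableau_act t \<gamma> = tableau_act t \<rho>}"
    then have "\<gamma> \<in> hyperoct r" "tableau_act t \<gamma> = tableau_act t id"
      using row_group_column[OF t] col_group_column[OF t] by auto
    then show "\<gamma> \<in> {id}" using tableau_act_free[OF t _ hyperoct_id] by blast
  next
    have "id \<in> row_group r column t" by (simp add: row_group_def hyperoct_id)
    then show "\<gamma> \<in> {\<gamma> \<in> col_group r column t. \<exists>\<rho>\<in>row_group r column t. tableau_act t \<gamma> = tableau_act t \<rho>}"
      if "\<gamma> \<in> {id}" for \<gamma>
      using that hyperoct_id by (auto simp: col_group_column[OF t])
  qed
  then have "polytabloid r column t (tabloid r column t) = (1 :: 'f)"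
    by (simp add: polytabloid_at_tabloid[OF t t])
  then show ?thesis by auto
qed

lemma sign_module:
  obtains s :: "bitabloid \<Rightarrow> 'f::field"
  where "mcarrier (specht r column) = fun_space.span {s}" and "s \<noteq> 0"
    and "\<And>\<sigma>. \<sigma> \<in> hyperoct r \<Longrightarrow> mact (specht r column) s \<sigma> = fscale (of_int (hyp_sgn r \<sigma>)) s"
proof -
  obtain t where t: "t \<in> bitableaux r column" using bitableaux_column_nonempty by blast
  let ?s = "polytabloid r column t :: bitabloid \<Rightarrow> 'f"
  have "polytabloid r column u \<in> fun_space.span {?s}" if u: "u \<in> bitableaux r column" for u
  proof -
    obtain \<sigma> where s: "\<sigma> \<in> hyperoct r" "u = tableau_act t \<sigma>" using tableau_act_transitive[OF t u] .
    show ?thesis unfolding s(2) polytabloid_column_act[OF t s(1)]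
      by (intro fun_space.span_scale fun_space.span_base) simp
  qed
  then have "fun_space.span (polytabloid r column ` bitableaux r column) = fun_space.span {?s}"
    unfolding fun_space.span_eq using t fun_space.span_base by blast
  then show thesis
    by (intro that[of ?s])
      (simp_all only: specht_simps polytabloid_column_nonzero[OF t] polytabloid_act
        polytabloid_column_act[OF t] not_False_eq_True)
qed

end

section \<open>Duality between the Specht modules of conjugate bi-partitions\<close>

text \<open>
  Two modules that are mapped bijectively and compatibly onto the same space are isomorphic; the
  closure of \<open>W\<close> under its operations is what makes the inverse of \<open>g\<close> a homomorphism.
\<close>

lemma hmod_iso_via:
  assumes f: "bij_betw f (mcarrier V) C" and g: "bij_betw g (mcarrier W) C"
    and f_hom: "\<And>x y. x \<in> mcarrier V \<Longrightarrow> y \<in> mcarrier V \<Longrightarrow> f (madd V x y) = add (f x) (f y)"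
      "\<And>c x. x \<in> mcarrier V \<Longrightarrow> f (mscale V c x) = scale c (f x)"
      "\<And>\<sigma> x. \<sigma> \<in> hyperoct r \<Longrightarrow> x \<in> mcarrier V \<Longrightarrow> f (mact V x \<sigma>) = act (f x) \<sigma>"
    and g_hom: "\<And>x y. x \<in> mcarrier W \<Longrightarrow> y \<in> mcarrier W \<Longrightarrow> g (madd W x y) = add (g x) (g y)"
      "\<And>c x. x \<in> mcarrier W \<Longrightarrow> g (mscale W c x) = scale c (g x)"
      "\<And>\<sigma> x. \<sigma> \<in> hyperoct r \<Longrightarrow> x \<in> mcarrier W \<Longrightarrow> g (mact W x \<sigma>) = act (g x) \<sigma>"
    and closed: "\<And>x y. x \<in> mcarrier W \<Longrightarrow> y \<in> mcarrier W \<Longrightarrow> madd W x y \<in> mcarrier W"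
      "\<And>c x. x \<in> mcarrier W \<Longrightarrow> mscale W c x \<in> mcarrier W"
      "\<And>\<sigma> x. \<sigma> \<in> hyperoct r \<Longrightarrow> x \<in> mcarrier W \<Longrightarrow> mact W x \<sigma> \<in> mcarrier W"
  shows "hmod_iso r V W"
proof -
  let ?h = "inv_into (mcarrier W) g \<circ> f"
  have h: "?h x \<in> mcarrier W" "g (?h x) = f x" if "x \<in> mcarrier V" for x
  proof -
    have "f x \<in> g ` mcarrier W" using that f g by (auto simp: bij_betw_def)
    then show "?h x \<in> mcarrier W" "g (?h x) = f x"
      by (simp_all add: inv_into_into f_inv_into_f)
  qed
  have hI: "?h x = y" if "y \<in> mcarrier W" "f x = g y" for x y
    using that g by (simp add: bij_betw_def)
  have "bij_betw ?h (mcarrier V) (mcarrier W)"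
    using f bij_betw_inv_into[OF g] by (rule bij_betw_trans)
  moreover have "?h (madd V x y) = madd W (?h x) (?h y)"
    if "x \<in> mcarrier V" "y \<in> mcarrier V" for x y
    using that h by (intro hI closed) (simp_all add: f_hom g_hom del: comp_apply)
  moreover have "?h (mscale V c x) = mscale W c (?h x)" if "x \<in> mcarrier V" for c x
    using that h by (intro hI closed) (simp_all add: f_hom g_hom del: comp_apply)
  moreover have "?h (mact V x \<sigma>) = mact W (?h x) \<sigma>"
    if "\<sigma> \<in> hyperoct r" "x \<in> mcarrier V" for \<sigma> x
    using that h by (intro hI closed) (simp_all add: f_hom g_hom del: comp_apply)
  ultimately show ?thesis unfolding hmod_iso_def by (intro exI[of _ ?h]) blast
qed

lemma hmod_iso_trans:
  assumes "hmod_iso r U V" "hmod_iso r V W"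
  shows "hmod_iso r U W"
proof -
  obtain f where f: "bij_betw f (mcarrier U) (mcarrier V)"
     "\<forall>x\<in>mcarrier U. \<forall>y\<in>mcarrier U. f (madd U x y) = madd V (f x) (f y)"
     "\<forall>c. \<forall>x\<in>mcarrier U. f (mscale U c x) = mscale V c (f x)"
     "\<forall>\<sigma>\<in>hyperoct r. \<forall>x\<in>mcarrier U. f (mact U x \<sigma>) = mact V (f x) \<sigma>"
    using assms(1) unfolding hmod_iso_def by blast
  obtain g where g: "bij_betw g (mcarrier V) (mcarrier W)"
     "\<forall>x\<in>mcarrier V. \<forall>y\<in>mcarrier V. g (madd V x y) = madd W (g x) (g y)"
     "\<forall>c. \<forall>x\<in>mcarrier V. g (mscale V c x) = mscale W c (g x)"
     "\<forall>\<sigma>\<in>hyperoct r. \<forall>x\<in>mcarrier V. g (mact V x \<sigma>) = mact W (g x) \<sigma>"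
    using assms(2) unfolding hmod_iso_def by blast
  have "f x \<in> mcarrier V" if "x \<in> mcarrier U" for x
    using f(1) that by (rule bij_betw_apply)
  then show ?thesis
    unfolding hmod_iso_def using f g bij_betw_trans[OF f(1) g(1)]
    by (intro exI[of _ "g \<circ> f"]) simp
qed

text \<open>
  Both modules are realised by the same functions on bi-tableaux, namely the combinations of the
  functions \<open>u \<mapsto> e\<^bsub>u'\<^esub>({t'})\<close>, where \<open>t'\<close> is the transpose of \<open>t\<close>.
  A linear form \<open>\<phi>\<close> on the Specht module of the conjugate becomes the function
  \<open>u \<mapsto> \<phi>(e\<^bsub>u'\<^esub>)\<close>, and an element \<open>v\<close> of the Specht module becomes the function whose value at
  \<open>u\<close> is the coefficient of \<open>{u}\<close> in \<open>v\<close> times the sign of \<open>u\<close>.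
\<close>

lemma dual_specht_iso_sign_twist:
  assumes lam: "is_bipartition r lam"
  shows "hmod_iso r (dual_specht r (biconjugate lam) :: ('f::field, (bitabloid \<Rightarrow> 'f) \<Rightarrow> 'f) hmod)
    (sign_twist r (specht r lam))"
proof -
  let ?U = "bitableaux r lam" and ?bc = "biconjugate lam"
  let ?S = "specht r lam :: ('f, bitabloid \<Rightarrow> 'f) hmod"
  let ?S' = "specht r ?bc :: ('f, bitabloid \<Rightarrow> 'f) hmod"
  define e where "e u = (polytabloid r ?bc (transpose_tableau u) :: _ \<Rightarrow> 'f)" for u
  define col where "col X = (\<lambda>u. if u \<in> ?U then e u X else 0)" for X
  define D where "D \<phi> = (\<lambda>u. if u \<in> ?U then \<phi> (e u) else 0)" for \<phi> :: "(bitabloid \<Rightarrow> 'f) \<Rightarrow> 'f"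
  define \<epsilon> where "\<epsilon> u = (of_int (tableau_sign r lam u) :: 'f)" for u
  define G where "G v = (\<lambda>u. if u \<in> ?U then \<epsilon> u * v (tabloid r lam u) else 0)" for v :: "bitabloid \<Rightarrow> 'f"
  define act where "act f \<sigma> = (\<lambda>u. f (tableau_act u (inv \<sigma>)))" for f :: "bitableau \<Rightarrow> 'f" and \<sigma>
  interpret S: fun_module r ?S by (rule fun_module_specht)
  have \<epsilon>_square: "\<epsilon> u * \<epsilon> u = 1" for u
    unfolding \<epsilon>_def of_int_mult[symmetric] by simp
  have \<epsilon>_act: "\<epsilon> (tableau_act t \<sigma>) = of_int (hyp_sgn r \<sigma>) * \<epsilon> t" if "t \<in> ?U" "\<sigma> \<in> hyperoct r" for t \<sigma>
    using that by (simp add: \<epsilon>_def tableau_sign_act)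
  have e_span: "mcarrier ?S' = fun_space.span (e ` ?U)"
    unfolding specht_simps e_def transpose_tableau_image[OF lam, symmetric] image_image ..
  have e_act: "perm_act (e u) \<sigma> = e (tableau_act u \<sigma>)" if "\<sigma> \<in> hyperoct r" for u \<sigma>
    using that by (simp add: e_def polytabloid_act transpose_tableau_act)

  have D: "bij_betw D (mcarrier (dual_specht r ?bc)) (fun_space.span (col ` tabloids r ?bc))"
    unfolding D_def col_def dual_specht_def
  proof (rule dual_row_space_eq_column_space)
    show "finite (tabloids r ?bc)" by (simp add: tabloids_eq finite_bitableaux)
    show "e u X = 0" if "u \<in> ?U" "X \<notin> tabloids r ?bc" for u X
      using that by (simp add: e_def polytabloid_outside transpose_tableau_bitableaux[OF lam])
  qed (simp_all add: e_span specht_simps(2-))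

  have G_polytabloid: "G (polytabloid r lam t) = fscale (\<epsilon> t) (col (tabloid r ?bc (transpose_tableau t)))"
    if t: "t \<in> ?U" for t
  proof
    fix u
    show "G (polytabloid r lam t) u = fscale (\<epsilon> t) (col (tabloid r ?bc (transpose_tableau t))) u"
    proof (cases "u \<in> ?U")
      case True
      then obtain \<sigma> where s: "\<sigma> \<in> hyperoct r" "u = tableau_act t \<sigma>"
        using tableau_act_transitive[OF t] by blast
      have "\<epsilon> u * polytabloid r lam t (tabloid r lam u) =
          \<epsilon> t * (of_int (hyp_sgn r \<sigma> * hyp_sgn r \<sigma>) * e u (tabloid r ?bc (transpose_tableau t)))"
        using \<epsilon>_act[OF t s(1)] polytabloid_transpose[OF lam t s(1), where 'f = 'f]
        by (simp add: s(2) e_def del: hyp_sgn_square)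
      then show ?thesis using True by (simp only: hyp_sgn_square) (simp add: G_def col_def fscale_apply)
    qed (simp add: G_def col_def fscale_apply)
  qed
  have G_linear: "G (v + w) = G v + G w" "G (fscale c v) = fscale c (G v)" "G 0 = 0" for v w c
    by (auto simp: G_def fscale_def fun_eq_iff algebra_simps)
  have "bij_betw G (mcarrier ?S) (fun_space.span (col ` tabloids r ?bc))"
    unfolding bij_betw_def
  proof
    show "inj_on G (mcarrier ?S)"
    proof (rule inj_onI, rule ext)
      fix v w X assume v: "v \<in> mcarrier ?S" and w: "w \<in> mcarrier ?S" and "G v = G w"
      then have "G v u = G w u" for u by simp
      then have "\<epsilon> u * (\<epsilon> u * v (tabloid r lam u)) = \<epsilon> u * (\<epsilon> u * w (tabloid r lam u))"
        if "u \<in> ?U" for u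
        using that by (metis (no_types) G_def)
      then have "v (tabloid r lam u) = w (tabloid r lam u)" if "u \<in> ?U" for u
        using that by (simp add: mult.assoc[symmetric] \<epsilon>_square)
      then show "v X = w X"
        using specht_outside[OF v] specht_outside[OF w]
        by (cases "X \<in> tabloids r lam") (auto simp: tabloids_eq)
    qed
    interpret vector_space_pair "fscale :: 'f \<Rightarrow> (bitabloid \<Rightarrow> 'f) \<Rightarrow> _"
      "fscale :: 'f \<Rightarrow> (bitableau \<Rightarrow> 'f) \<Rightarrow> _" by unfold_locales
    have "Vector_Spaces.linear fscale fscale G" by unfold_locales (simp_all add: G_linear)
    then have "G ` mcarrier ?S = fun_space.span (G ` polytabloid r lam ` ?U)"
      unfolding specht_simps by (rule linear_span_image[symmetric])
    also have "\<dots> = fun_space.span (col ` tabloids r ?bc)"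
      unfolding fun_space.span_eq
    proof
      show "G ` polytabloid r lam ` ?U \<subseteq> fun_space.span (col ` tabloids r ?bc)"
      proof clarify
        fix t assume t: "t \<in> ?U"
        then have "tabloid r ?bc (transpose_tableau t) \<in> tabloids r ?bc"
          by (simp add: tabloids_eq transpose_tableau_bitableaux[OF lam])
        then show "G (polytabloid r lam t) \<in> fun_space.span (col ` tabloids r ?bc)"
          unfolding G_polytabloid[OF t] by (intro fun_space.span_scale fun_space.span_base imageI)
      qed
      show "col ` tabloids r ?bc \<subseteq> fun_space.span (G ` polytabloid r lam ` ?U)"
      proof
        fix w assume "w \<in> col ` tabloids r ?bc"
        then obtain t where t: "t \<in> ?U" "w = col (tabloid r ?bc (transpose_tableau t))"
          by (auto simp: tabloids_eq simp flip: transpose_tableau_image[OF lam])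
        have "w = fscale (\<epsilon> t) (G (polytabloid r lam t))"
          by (simp add: G_polytabloid t \<epsilon>_square)
        then show "w \<in> fun_space.span (G ` polytabloid r lam ` ?U)"
          using t(1) by (metis fun_space.span_scale fun_space.span_base imageI)
      qed
    qed
    finally show "G ` mcarrier ?S = fun_space.span (col ` tabloids r ?bc)" .
  qed
  then have G: "bij_betw G (mcarrier (sign_twist r ?S)) (fun_space.span (col ` tabloids r ?bc))"
    by (simp add: sign_twist_def)

  show ?thesis
  proof (rule hmod_iso_via[OF D G, where add = "(+)" and scale = fscale and act = act])
    fix \<sigma> and \<phi> :: "(bitabloid \<Rightarrow> 'f) \<Rightarrow> 'f" assume s: "\<sigma> \<in> hyperoct r"
    show "D (mact (dual_specht r ?bc) \<phi> \<sigma>) = act (D \<phi>) \<sigma>"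
    proof
      fix u
      have "e u \<in> fun_space.span (e ` ?U)" if "u \<in> ?U"
        using that by (simp add: fun_space.span_base)
      then show "D (mact (dual_specht r ?bc) \<phi> \<sigma>) u = act (D \<phi>) \<sigma> u"
        by (simp add: D_def act_def dual_specht_def dual_def specht_simps(2-) e_span
            e_act[OF hyperoct_inv[OF s]] tableau_act_bitableaux_iff[OF hyperoct_inv[OF s]])
    qed
  next
    fix \<sigma> v assume s: "\<sigma> \<in> hyperoct r"
    show "G (mact (sign_twist r ?S) v \<sigma>) = act (G v) \<sigma>"
    proof
      fix u
      note si = hyperoct_inv[OF s]
      show "G (mact (sign_twist r ?S) v \<sigma>) u = act (G v) \<sigma> u"
        using \<epsilon>_act[OF _ si] tableau_act_bitableaux_iff[OF si, of u lam]
        by (simp add: G_def act_def sign_twist_def specht_simps fscale_apply perm_act_def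
            tabloid_act_tabloid[OF si] hyp_sgn_inv[OF s])
    qed
  next
    fix \<sigma> v assume "\<sigma> \<in> hyperoct r" "v \<in> mcarrier (sign_twist r ?S)"
    then show "mact (sign_twist r ?S) v \<sigma> \<in> mcarrier (sign_twist r ?S)"
      using S.act_closed fun_space.subspace_scale[OF S.subspace] by (simp add: sign_twist_def)
  qed (use fun_space.subspace_scale[OF S.subspace] fun_space.subspace_add[OF S.subspace] in
      \<open>auto simp: sign_twist_def S.madd S.mscale G_linear D_def fun_eq_iff dual_specht_def dual_def
        fscale_apply\<close>)
qed

theorem corollary2p3:
  fixes r p :: nat and lam :: bipart
  assumes "r \<ge> 1"
    and "is_bipartition r lam"
    and "CHAR('f::field) = p"
  shows "hmod_iso r
           (dual_specht r (biconjugate lam) :: ('f, (bitabloid \<Rightarrow> 'f) \<Rightarrow> 'f) hmod)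
           (tensor (specht r lam) (specht r (replicate r 1, [])))"
proof -
  obtain s :: "bitabloid \<Rightarrow> 'f"
    where "mcarrier (specht r (replicate r 1, [])) = fun_space.span {s}" "s \<noteq> 0"
      and "\<And>\<sigma>. \<sigma> \<in> hyperoct r \<Longrightarrow>
        mact (specht r (replicate r 1, [])) s \<sigma> = fscale (of_int (hyp_sgn r \<sigma>)) s"
    using sign_module by blast
  then have "hmod_iso r (sign_twist r (specht r lam))
      (tensor (specht r lam) (specht r (replicate r 1, [])) :: ('f, _) hmod)"
    by (intro sign_twist_iso_tensor[where s = s] fun_module_specht)
  then show ?thesis by (rule hmod_iso_trans[OF dual_specht_iso_sign_twist[OF assms(2)]])
qed

end
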